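(* Let $q=3^r$ with $r$ a positive integer. Then the following hold. (a) For $h=1,2,\ldots$, $$SK^h=\sum_{j=0}^{h-1}(-1)^{h+j+1}\binom{h}{j}(q^2-1)^{h-j}SK^j+q^{1-h}\sum_{j=0}^{\min\{N_1,h\}}(-1)^{h+j}C_{1,j}\sum_{t=j}^{h}t!\,S(h,t)\,3^{h-t}\,2^{t-h-j-1}\binom{N_1-j}{N_1-t},$$ where $N_1=|Sp(2,q)|=q(q^2-1)$ and $\{C_{1,j}\}_{j=0}^{N_1}$ is the weight distribution of the ternary linear code $C(Sp(2,q))$, given for $j=0,\ldots,N_1$ by $$C_{1,j}=\sum\binom{q^2}{\nu_1,\mu_1}\binom{q^2}{\nu_{-1},\mu_{-1}}\prod_{\beta^2-1\neq 0\ \text{square}}\binom{q^2+q}{\nu_\beta,\mu_\beta}\prod_{\beta^2-1\ \text{nonsquare}}\binom{q^2-q}{\nu_\beta,\mu_\beta}.$$ Here the products are over the $\beta\in\mathbb{F}_q$ with the indicated property, and the sum is over all families of nonnegative integers $\{\nu_\beta\}_{\beta\in\mathbb{F}_q}$ and $\{\mu_\beta\}_{\beta\in\mathbb{F}_q}$ satisfying $\sum_{\beta\in\mathbb{F}_q}\nu_\beta+\sum_{\beta\in\mathbb{F}_q}\mu_\beta=j$ and $\sum_{\beta\in\mathbb{F}_q}\nu_\beta\beta=\sum_{\beta\in\mathbb{F}_q}\mu_\beta\beta$ (the latter an identity in $\mathbb{F}_q$). (b) For $h=1,2,\ldots$, $$SK^{2h}=\sum_{j=0}^{h-1}(-1)^{h+j+1}\binom{h}{j}(q^6-q^4-q^3-q^2+q+1)^{h-j}SK^{2j}+q^{1-4h}\sum_{j=0}^{\min\{N_2,h\}}(-1)^{h+j}C_{2,j}\sum_{t=j}^{h}t!\,S(h,t)\,3^{h-t}\,2^{t-h-j-1}\binom{N_2-j}{N_2-t},$$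 where $N_2=|Sp(4,q)|=q^4(q^2-1)(q^4-1)$ and $\{C_{2,j}\}_{j=0}^{N_2}$ is the weight distribution of the ternary linear code $C(Sp(4,q))$, given for $j=0,\ldots,N_2$ by $$C_{2,j}=\sum\binom{q^4(\delta(2,q;0)+q^5-q^2-3q+3)}{\nu_0,\mu_0}\prod_{\beta\in\mathbb{F}_q^*}\binom{q^4(\delta(2,q;\beta)+q^5-q^3-q^2-2q+3)}{\nu_\beta,\mu_\beta}.$$ Here the sum is over all families of nonnegative integers $\{\nu_\beta\}_{\beta\in\mathbb{F}_q}$ and $\{\mu_\beta\}_{\beta\in\mathbb{F}_q}$ satisfying $\sum_{\beta\in\mathbb{F}_q}\nu_\beta+\sum_{\beta\in\mathbb{F}_q}\mu_\beta=j$ and $\sum_{\beta\in\mathbb{F}_q}\nu_\beta\beta=\sum_{\beta\in\mathbb{F}_q}\mu_\beta\beta$ (the latter an identity in $\mathbb{F}_q$), and, for every $\beta\in\mathbb{F}_q$, $\delta(2,q;\beta)=|\{(\alpha_1,\alpha_2)\in(\mathbb{F}_q^* )^2 : \alpha_1+\alpha_1^{-1}+\alpha_2+\alpha_2^{-1}=\beta\}|$.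
   Context: $\mathbb{F}_q$ is the finite field with $q=3^r$ elements. Let $tr(x)=x+x^3+\cdots+x^{3^{r-1}}$ be the trace function $\mathbb{F}_q\to\mathbb{F}_3$ and $\lambda(x)=e^{2\pi i\,tr(x)/3}$ the canonical additive character of $\mathbb{F}_q$. For $a\in\mathbb{F}_q^*$ the Kloosterman sum is $K(\lambda;a)=\sum_{\alpha\in\mathbb{F}_q^*}\lambda(\alpha+a\alpha^{-1})$. For each integer $h\ge 0$, the $h$-th moment of Kloosterman sums with square arguments is $$SK^h=\sum_{a\in\mathbb{F}_q^*,\ a\ \text{a square}}K(\lambda;a)^h$$ (the superscript $h$ in $SK^h$ is an index, not a power; $K(\lambda;a)^0=1$). The symplectic group is $Sp(2n,q)=\{w\in GL(2n,q) : {}^twJw=J\}$ with $J=\begin{bmatrix}0&1_n\\-1_n&0\end{bmatrix}$. Codes: put $G_1=Sp(2,q)$, $G_2=Sp(4,q)$, $N_i=|G_i|$. For $i=1,2$ fix an ordering $g_1,\ldots,g_{N_i}$ of the elements of $G_i$ and set $v_i=(\mathrm{Tr}\,g_1,\ldots,\mathrm{Tr}\,g_{N_i})\in\mathbb{F}_q^{N_i}$, where $\mathrm{Tr}$ is the matrix trace. Then $C(G_i)=\{u\in\mathbb{F}_3^{N_i} : u\cdot v_i=0\}$, with $\cdot$ the usual inner product in $\mathbb{F}_q^{N_i}$. Its weight distribution $\{C_{i,j}\}_{j=0}^{N_i}$ is given by: $C_{i,j}$ is the number of codewords of $C(G_i)$ of Hamming weight $j$. For nonnegative integers $a,b,c$: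 $\binom{c}{a,b}=\frac{c!}{a!\,b!\,(c-a-b)!}$ if $a+b\le c$, and $\binom{c}{a,b}=0$ if $a+b>c$. The Stirling number of the second kind is $S(h,t)=\frac{1}{t!}\sum_{j=0}^t(-1)^{t-j}\binom{t}{j}j^h$. An ordinary binomial coefficient $\binom{N-j}{N-t}$ with $t>N$ is $0$. *)

theory Defs
  imports
    Complex_Main
    "HOL-Library.Cardinality"
    "HOL-Computational_Algebra.Nth_Powers"
    "HOL-Combinatorics.Stirling"
    "Jordan_Normal_Form.Matrix"
begin

section \<open>Kloosterman sums over a finite field with \<open>3 ^ r\<close> elements\<close>

text \<open>
  A finite field with \<open>3 ^ r\<close> elements is a type \<open>'a :: {field, finite}\<close> with
  \<open>CARD('a) = 3 ^ r\<close>. The exponent \<open>r\<close> is an explicit argument of the trace and of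
  everything built on it.
\<close>

definition field_trace :: "nat \<Rightarrow> 'a::{field,finite} \<Rightarrow> 'a" where
  "field_trace r x = (\<Sum>i<r. x ^ (3 ^ i))"

text \<open>
  The trace lies in the prime subfield. The number \<open>k\<close> below identifies its value with
  a residue modulo 3.
\<close>

definition add_char :: "nat \<Rightarrow> 'a::{field,finite} \<Rightarrow> complex" where
  "add_char r x =
     exp (2 * of_real pi * \<i> * of_nat (THE k. k < 3 \<and> of_nat k = field_trace r x) / 3)"

definition kloosterman :: "nat \<Rightarrow> 'a::{field,finite} \<Rightarrow> complex" where
  "kloosterman r a = (\<Sum>\<alpha>\<in>UNIV - {0}. add_char r (\<alpha> + a * inverse \<alpha>))"

definition SK :: "'a::{field,finite} itself \<Rightarrow> nat \<Rightarrow> nat \<Rightarrow> complex" where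
  "SK _ r h = (\<Sum>a | a \<noteq> (0::'a) \<and> is_square a. kloosterman r a ^ h)"


section \<open>Symplectic groups and their trace codes\<close>

definition symplectic_form :: "nat \<Rightarrow> 'a::field mat" where
  "symplectic_form n = four_block_mat (0\<^sub>m n n) (1\<^sub>m n) (- 1\<^sub>m n) (0\<^sub>m n n)"

definition Sp :: "nat \<Rightarrow> 'a::field mat set" where
  "Sp n = {w \<in> carrier_mat (2 * n) (2 * n). invertible_mat w \<and>
             transpose_mat w * symplectic_form n * w = symplectic_form n}"

definition mat_trace :: "'a::comm_monoid_add mat \<Rightarrow> 'a" where
  "mat_trace A = (\<Sum>i<dim_row A. A $$ (i, i))"

definition prime_subfield :: "'a::field set" where
  "prime_subfield = range of_int"

text \<open>
  The words of the code have their entries in the prime subfield of \<open>'a\<close>, which in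
  characteristic 3 is the field with three elements. The list \<open>gs\<close> is an ordering of
  the group.
\<close>

definition trace_code :: "'a::field mat list \<Rightarrow> 'a vec set" where
  "trace_code gs = {u \<in> carrier_vec (length gs).
     (\<forall>i<length gs. u $ i \<in> prime_subfield) \<and> u \<bullet> vec_of_list (map mat_trace gs) = 0}"

definition hamming_weight :: "'a::zero vec \<Rightarrow> nat" where
  "hamming_weight u = card {i. i < dim_vec u \<and> u $ i \<noteq> 0}"

definition weight_distribution :: "'a::zero vec set \<Rightarrow> nat \<Rightarrow> nat" where
  "weight_distribution C j = card {u \<in> C. hamming_weight u = j}"


section \<open>Combinatorial quantities\<close>

text \<open>The division is exact.\<close>

definition trinomial :: "nat \<Rightarrow> nat \<Rightarrow> nat \<Rightarrow> nat" where
  "trinomial c a b =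
     (if a + b \<le> c then fact c div (fact a * fact b * fact (c - a - b)) else 0)"

definition weight_families :: "nat \<Rightarrow> (('a::{field,finite} \<Rightarrow> nat) \<times> ('a \<Rightarrow> nat)) set" where
  "weight_families j = {(\<nu>, \<mu>).
     (\<Sum>\<beta>\<in>UNIV. \<nu> \<beta>) + (\<Sum>\<beta>\<in>UNIV. \<mu> \<beta>) = j \<and>
     (\<Sum>\<beta>\<in>UNIV. of_nat (\<nu> \<beta>) * \<beta>) = (\<Sum>\<beta>\<in>UNIV. of_nat (\<mu> \<beta>) * \<beta>)}"

definition delta2 :: "'a::{field,finite} \<Rightarrow> nat" where
  "delta2 \<beta> = card {(\<alpha>1, \<alpha>2). \<alpha>1 \<noteq> 0 \<and> \<alpha>2 \<noteq> 0 \<and>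
     \<alpha>1 + inverse \<alpha>1 + \<alpha>2 + inverse \<alpha>2 = \<beta>}"

text \<open>
  The Stirling numbers of the second kind are those of the library, which are defined by
  recursion. They agree with the explicit alternating sum.
\<close>

lemma Stirling_explicit:
  "real (Stirling h t) =
     1 / fact t * (\<Sum>j=0..t. (-1) ^ (t - j) * real (t choose j) * real j ^ h)"
proof -
  define A where "A h t = (\<Sum>j\<le>t. (-1) ^ (t - j) * real (t choose j) * real j ^ h)" for h t
  have rec: "A (Suc n) (Suc k) = (1 + real k) * (A n (Suc k) + A n k)" for n k
  proof -
    have *: "real j * real (Suc k choose j) =
               (1 + real k) * (real (Suc k choose j) - real (k choose j))" for j
    proof (cases j)
      case (Suc i)
      have "Suc i * (Suc k choose Suc i) = Suc k * (k choose i)"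
        by (metis Suc_times_binomial_eq mult.commute)
      then have "real (Suc i * (Suc k choose Suc i)) = real (Suc k * (k choose i))"
        by (rule arg_cong)
      then show ?thesis using Suc by (simp add: algebra_simps)
    qed simp
    have "A (Suc n) (Suc k) =
        (\<Sum>j\<le>Suc k. (-1) ^ (Suc k - j) * (real j * real (Suc k choose j)) * real j ^ n)"
      unfolding A_def by (intro sum.cong) (auto simp: mult_ac)
    also have "\<dots> = (1 + real k) * (A n (Suc k) -
        (\<Sum>j\<le>Suc k. (-1) ^ (Suc k - j) * real (k choose j) * real j ^ n))"
      unfolding A_def * sum_subtractf[symmetric] sum_distrib_left
      by (intro sum.cong) (auto simp: algebra_simps)
    also have "(\<Sum>j\<le>Suc k. (-1) ^ (Suc k - j) * real (k choose j) * real j ^ n) = - A n k"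
      unfolding A_def by (auto simp: sum_negf[symmetric] Suc_diff_le intro!: sum.cong)
    finally show ?thesis by simp
  qed
  have "A h t = fact t * real (Stirling h t)"
  proof (induction h t rule: Stirling.induct)
    case (2 k)
    have "(\<Sum>i\<le>Suc k. (-1) ^ i * real (Suc k choose i)) = 0"
      by (rule choose_alternating_sum) simp
    moreover have "A 0 (Suc k) = (-1) ^ Suc k * (\<Sum>i\<le>Suc k. (-1) ^ i * real (Suc k choose i))"
      unfolding A_def sum_distrib_left
    proof (intro sum.cong refl)
      fix j assume "j \<in> {..Suc k}"
      then have "(-1::real) ^ (Suc k - j) = (-1) ^ Suc k * (-1) ^ j"
        by (subst power_diff) (auto simp flip: power_inverse simp: divide_inverse)
      then show "(-1) ^ (Suc k - j) * real (Suc k choose j) * real j ^ 0 =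
                 (-1) ^ Suc k * ((-1) ^ j * real (Suc k choose j))" by simp
    qed
    ultimately show ?case by simp
  qed (simp_all add: rec algebra_simps, simp_all add: A_def)
  then show ?thesis by (simp add: A_def atLeast0AtMost)
qed

end

theory Submission
  imports
    Defs
    "HOL-Library.FuncSet"
    "HOL-Computational_Algebra.Polynomial"
    "Jordan_Normal_Form.Determinant"
begin

text \<open>
  A word of the dual code is indexed by \<open>a \<in> F\<^sub>q\<close>, and its weight is
  \<open>2/3 (N - G a)\<close> with the Gauss sum \<open>G a = \<Sum>\<^sub>g \<lambda> (a Tr g)\<close>. For \<open>a \<noteq> 0\<close> this sum is
  \<open>q K(a\<^sup>2)\<close> for \<open>Sp(2, q)\<close> and \<open>q\<^sup>4 (K(a\<^sup>2)\<^sup>2 + q\<^sup>3 - q)\<close> for \<open>Sp(4, q)\<close>. Pless' power moment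
  identity, obtained by comparing coefficients in the MacWilliams identity, expresses the power sums
  of these weights by the weight distribution, and the binomial theorem turns them into the recursion
  for the moments. The weight distributions follow from the number of group elements with a given
  trace, which for \<open>Sp(4, q)\<close> comes from the Gauss sum by Fourier inversion.

  In \<open>Sp(4, q)\<close> only the matrices whose lower left block \<open>C\<close> is antisymmetric contribute to the
  Gauss sum. If \<open>C \<noteq> 0\<close> they all have trace \<open>0\<close>; if \<open>C = 0\<close> the sum reduces to one of
  \<open>\<lambda> (a (tr A + tr A\<^sup>-\<^sup>1))\<close> over \<open>A \<in> GL(2, q)\<close>.
\<close>

section \<open>The additive character\<close>

text \<open>The Gauss sum at \<open>a\<close> depends on \<open>a\<close> only through a^2, and
  every nonzero square comes from exactly two \<open>a\<close>; hence moments over square arguments.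
  For both groups it has the form N - c (M - L (a^2)), with L = K, c = q or L = K^2, c = q^4, so the
  weights are 2/3 c (M - L (a^2)). This explains the constants of the recursion: M is the base of
  its powers, and the factor q / c^h, with q from the MacWilliams identity, is q^(1 - h) or q^(1 - 4
  h). The powers of 2 and 3 in the inner sum come from the Fourier transform on the field with three
  elements, after the common factor 2 (2/3)^h has cancelled.\<close>

locale ternary_field =
  fixes r q :: nat and T :: "'a::{field,finite} itself"
  assumes q_eq: "q = 3 ^ r" and card_field: "CARD('a) = q"
begin

section \<open>Arithmetic and trace in a field with 3^r elements\<close>

lemma q_gt_1: "1 < q"
proof -
  have "card {0, 1::'a} \<le> CARD('a)" by (intro card_mono) auto
  then show ?thesis by (simp add: card_field)
qed

text \<open>Shifting the summation variable by 1 permutes the field, so the q added ones sum to 0.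
  As \<open>q\<close> is a power of 3, the characteristic is 3.\<close>

lemma of_nat_card: "of_nat q = (0::'a)"
proof -
  have "(\<Sum>y\<in>UNIV. y + (1 :: 'a)) = (\<Sum>y\<in>UNIV. y)"
    by (rule sum.reindex_bij_witness[of _ "\<lambda>y. y - 1" "\<lambda>y. y + 1"]) auto
  then show ?thesis by (simp add: sum.distrib card_field)
qed

lemma three_eq_0: "(3::'a) = 0"
  using of_nat_card by (simp add: q_eq)

lemma two_eq: "(2::'a) = - 1"
  using three_eq_0 by (simp add: eq_neg_iff_add_eq_0)

lemma one_neq_minus_one: "(1::'a) \<noteq> - 1"
proof
  assume "(1::'a) = - 1"
  then have "(2::'a) = 1 + (- 1)" by simp
  then show False using two_eq by simp
qed

text \<open>Multiplication by \<open>x\<close> permutes the nonzero elements, so their product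
  absorbs the factor x^(q - 1) and can be cancelled.\<close>

lemma power_card_minus_one: "x \<noteq> 0 \<Longrightarrow> x ^ (q - 1) = (1::'a)"
proof -
  assume x: "x \<noteq> 0"
  have "(\<Prod>y\<in>UNIV - {0}. x * y) = (\<Prod>y\<in>UNIV - {0::'a}. y)"
    by (rule prod.reindex_bij_witness[of _ "\<lambda>y. y / x" "\<lambda>y. x * y"]) (use x in auto)
  moreover have "(\<Prod>y\<in>UNIV - {0::'a}. y) \<noteq> 0" by simp
  ultimately show ?thesis by (simp add: prod.distrib card_Diff_subset card_field)
qed

lemma power_card: "x ^ q = (x::'a)"
proof (cases "x = 0")
  case True
  then show ?thesis using q_gt_1 by simp
next
  case False
  have "x ^ q = x ^ Suc (q - 1)" using q_gt_1 by simp
  then show ?thesis using power_card_minus_one[OF False] by simp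
qed

lemma cube_add: "(x + y) ^ 3 = x ^ 3 + (y::'a) ^ 3"
proof -
  have "(x + y) ^ 3 = x ^ 3 + y ^ 3 + 3 * (x ^ 2 * y + x * y ^ 2)"
    by (simp add: power2_eq_square power3_eq_cube algebra_simps)
  then show ?thesis by (simp add: three_eq_0)
qed

lemma frobenius_add: "(x + y) ^ (3 ^ i) = x ^ (3 ^ i) + (y::'a) ^ (3 ^ i)"
  by (induction i) (simp_all add: power_mult mult.commute[of 3] cube_add)

lemma cube_sum: "(\<Sum>i\<in>A. f i) ^ 3 = (\<Sum>i\<in>A. (f i :: 'a) ^ 3)"
  by (induction A rule: infinite_finite_induct) (simp_all add: cube_add)

lemma field_trace_add: "field_trace r (x + y) = field_trace r x + (field_trace r y :: 'a)"
  by (simp add: field_trace_def frobenius_add sum.distrib)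

lemma field_trace_0: "field_trace r 0 = (0::'a)"
  by (simp add: field_trace_def zero_power)

lemma field_trace_minus: "field_trace r (- x) = - (field_trace r x :: 'a)"
  using field_trace_add[of x "- x"] by (simp add: field_trace_0 eq_neg_iff_add_eq_0 add.commute)

lemma cube_eq_self: "(y::'a) ^ 3 = y \<longleftrightarrow> y \<in> {0, 1, - 1}"
proof -
  have "y ^ 3 = y \<longleftrightarrow> y * (y - 1) * (y + 1) = 0" by (simp add: algebra_simps power3_eq_cube)
  also have "\<dots> \<longleftrightarrow> y \<in> {0, 1, - 1}" by (auto simp: eq_neg_iff_add_eq_0)
  finally show ?thesis .
qed

text \<open>The trace is fixed by cubing: cubing moves every exponent 3^i up to the next, the added
  \<open>x\<close> supplies the exponent lost at the bottom, and x^q = x closes the cycle at the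
  top.\<close>

lemma field_trace_values: "field_trace r x \<in> {0, 1, - 1 :: 'a}"
proof -
  have "(field_trace r x) ^ 3 + x = (\<Sum>i<r. x ^ (3 ^ Suc i)) + x ^ (3 ^ 0)"
    by (simp add: field_trace_def cube_sum power_mult[symmetric] mult.commute)
  also have "\<dots> = (\<Sum>i<Suc r. x ^ (3 ^ i))" 
    by (subst sum.lessThan_Suc_shift) simp
  also have "\<dots> = field_trace r x + x"
    using power_card[of x] by (simp add: field_trace_def q_eq)
  finally have "(field_trace r x) ^ 3 = field_trace r x" by simp
  then show ?thesis by (simp add: cube_eq_self)
qed

text \<open>If the trace vanished everywhere, a nonzero polynomial of degree at most 3^(r - 1) would
  have q roots. Orthogonality of the character rests on this.\<close>

lemma field_trace_nonzero: "\<exists>x::'a. field_trace r x \<noteq> 0"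
proof (rule ccontr)
  assume "\<not> ?thesis"
  then have *: "field_trace r x = 0" for x :: 'a by blast
  obtain s where s: "r = Suc s" using q_gt_1 by (cases r) (auto simp: q_eq)
  define p :: "'a poly" where "p = (\<Sum>i<r. monom 1 (3 ^ i))"
  have "coeff p (3 ^ s) = (\<Sum>i<r. if 3 ^ i = (3::nat) ^ s then 1 else 0)"
    by (simp add: p_def coeff_sum)
  also have "\<dots> = 1" by (simp add: s)
  finally have p: "p \<noteq> 0" by auto
  have "degree p \<le> 3 ^ s"
    unfolding p_def by (rule degree_sum_le) (auto simp: s degree_monom_eq)
  moreover have "poly p x = 0" for x
    using *[of x] by (simp add: p_def poly_sum poly_monom field_trace_def)
  then have "{x. poly p x = 0} = UNIV" by auto
  then have "q \<le> degree p" using card_poly_roots_bound[OF p] by (simp add: card_field)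
  moreover have "(3::nat) ^ s > 0" by simp
  ultimately show False by (simp add: q_eq s)
qed

section \<open>The cube root of unity and the additive character\<close>

definition omega :: complex where "omega = exp (2 * of_real pi * \<i> / 3)"

lemma omega_cube: "omega ^ 3 = 1"
proof -
  have "omega ^ 3 = exp (of_nat 3 * (2 * of_real pi * \<i> / 3))"
    unfolding omega_def exp_of_nat_mult ..
  also have "of_nat 3 * (2 * of_real pi * \<i> / 3) = 2 * of_real pi * \<i>" by simp
  finally show ?thesis by (simp only: exp_two_pi_i)
qed

lemma omega_neq_1: "omega \<noteq> 1"
proof
  assume "omega = 1"
  then have "Re omega = 1" by simp
  then show False
    by (simp add: omega_def Re_exp cos_120)
qed

lemma omega_sum: "1 + omega + omega ^ 2 = 0"
proof -
  have "(omega - 1) * (1 + omega + omega ^ 2) = omega ^ 3 - 1"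
    by (simp add: power2_eq_square power3_eq_cube algebra_simps)
  then show ?thesis using omega_cube omega_neq_1 by simp
qed

text \<open>Replaces the definite description in \<open>add_char\<close> by a case distinction; the
  residue 2 stands for the trace value - 1.\<close>

lemma add_char_cases:
  "add_char r (x::'a) = (if field_trace r x = 0 then 1 else if field_trace r x = 1 then omega
     else omega ^ 2)"
proof -
  have 01: "(0::'a) \<noteq> - 1" "(1::'a) \<noteq> 2" using one_neq_minus_one by (simp, simp only: two_eq not_False_eq_True)
  have *: "k < 3 \<longleftrightarrow> k = 0 \<or> k = 1 \<or> k = 2" for k :: nat by auto
  have t: "(THE k. k < 3 \<and> of_nat k = field_trace r x) =
      (if field_trace r x = 0 then 0 else if field_trace r x = 1 then 1 else (2::nat))"
    using field_trace_values[of x] one_neq_minus_one 01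
    by (intro the_equality) (auto simp: * two_eq)
  show ?thesis
    by (simp add: add_char_def t omega_def exp_of_nat_mult[symmetric] mult_ac)
qed

lemma add_char_0 [simp]: "add_char r (0::'a) = 1"
  by (simp add: add_char_cases field_trace_0)

lemma add_char_add: "add_char r (x + y) = add_char r x * add_char r (y::'a)"
proof -
  \<comment> \<open>Multiplication of cube roots of unity and, in the next facts, addition in the
    prime field: together they settle the nine combinations of trace values.\<close>
  have w: "omega ^ 2 * omega = 1" "omega * omega ^ 2 = 1" "omega ^ 2 * omega ^ 2 = omega" "(omega ^ 2) ^ 2 = omega"
    using omega_cube by (simp_all add: power2_eq_square power3_eq_cube mult_ac)
  have o: "1 + 1 = (- 1 :: 'a)" using two_eq by simp
  then have o': "- 1 + - 1 = (1::'a)" by (metis add.assoc add.right_inverse add_0 add.commute)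
  have n: "(0::'a) \<noteq> - 1" "- 1 \<noteq> (0::'a)" "- 1 \<noteq> (1::'a)" using one_neq_minus_one by auto
  from field_trace_values[of x] field_trace_values[of y] show ?thesis
    unfolding add_char_cases field_trace_add
    by (elim insertE emptyE; simp only: o o' n w one_neq_minus_one if_True if_False refl
        add_0_left add_0_right mult_1_left mult_1_right zero_neq_one one_neq_zero
        power2_eq_square[symmetric] power_one add.left_inverse add.right_inverse)
qed

lemma add_char_sum: "add_char r (\<Sum>i\<in>A. f i :: 'a) = (\<Prod>i\<in>A. add_char r (f i))"
  by (induction A rule: infinite_finite_induct) (simp_all add: add_char_add)

text \<open>Since 1 + omega + omega^2 = 0, the sum of \<lambda>(s x) over s in {0, 1, - 1} detects
  trace 0. This turns Hamming weights into character sums.\<close>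

lemma add_char_trace_indicator:
  "1 + add_char r x + add_char r (- x :: 'a) = (if field_trace r x = 0 then 3 else 0)"
proof -
  have n: "(0::'a) \<noteq> - 1" "- 1 \<noteq> (0::'a)" "- 1 \<noteq> (1::'a)" using one_neq_minus_one by auto
  from field_trace_values[of x] omega_sum show ?thesis
    unfolding add_char_cases field_trace_minus
    by (elim insertE emptyE; simp add: n algebra_simps)
qed

text \<open>Replacing x by x + y / b multiplies the sum by \<lambda>(y), and \<open>y\<close> can be
  chosen with \<lambda>(y) different from 1.\<close>

lemma sum_add_char:
  "(\<Sum>x\<in>UNIV. add_char r (b * x)) = (if b = (0::'a) then of_nat q else 0)"
proof (cases "b = 0")
  case False
  obtain y :: 'a where y: "field_trace r y \<noteq> 0" using field_trace_nonzero by blast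
  then have c: "add_char r y \<noteq> 1"
    using omega_neq_1 omega_cube by (auto simp: add_char_cases power2_eq_square power3_eq_cube)
  define S where "S = (\<Sum>x\<in>UNIV. add_char r (b * x))"
  have "S = (\<Sum>x\<in>UNIV. add_char r (b * (x + y / b)))"
    unfolding S_def
    by (rule sum.reindex_bij_witness[of _ "\<lambda>x. x + y / b" "\<lambda>x. x - y / b"]) auto
  also have "\<dots> = S * add_char r y"
    using False by (simp add: S_def sum_distrib_right distrib_left add_char_add)
  finally show ?thesis using c False by (simp add: S_def)
qed (simp add: card_field)

end

section \<open>Power moments of ternary codes\<close>

text \<open>The coefficients of (1 + X)^w are binomials, so the MacWilliams identity yields sums of
  \<open>w choose t\<close>; this expansion in falling factorials t! (w choose t) converts them into
  power sums.\<close>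

lemma power_eq_Stirling_sum:
  "w ^ h = (\<Sum>t\<le>h. Stirling h t * fact t * (w choose t))"
proof (induction h)
  case (Suc h)
  \<comment> \<open>With w = (w - t) + t, the first part lengthens the falling factorial and the
    second only scales it. This mirrors the recursion of the Stirling numbers.\<close>
  have step: "w * (fact t * (w choose t)) = fact (Suc t) * (w choose Suc t) + t * (fact t * (w choose t))" for t
  proof (cases "t \<le> w")
    case True
    have "Suc t * (w choose Suc t) = (w - t) * (w choose t)"
      by (simp only: binomial_absorption binomial_absorb_comp)
    then have "fact (Suc t) * (w choose Suc t) = fact t * ((w - t) * (w choose t))"
      by (simp only: fact_Suc of_nat_id mult_ac)
    moreover have "w = (w - t) + t" using True by simp
    then have "w * (fact t * (w choose t)) = fact t * ((w - t) * (w choose t)) + t * (fact t * (w choose t))"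
      by (metis distrib_right mult.left_commute)
    ultimately show ?thesis by simp
  qed (simp add: binomial_eq_0)
  define g where "g t = t * Stirling h t * fact t * (w choose t)" for t
  \<comment> \<open>\<open>g\<close> vanishes at 0 through its factor t and at h + 1 because
    \<open>Stirling h (Suc h)\<close> is 0, so shifting the index changes nothing.\<close>
  have shift: "(\<Sum>t\<le>h. g (Suc t)) = (\<Sum>t\<le>h. g t)"
    using sum.atMost_Suc_shift[of g h] by (simp add: g_def)
  have "w ^ Suc h = (\<Sum>t\<le>h. Stirling h t * (w * (fact t * (w choose t))))"
    by (simp add: Suc sum_distrib_left mult_ac)
  also have "\<dots> = (\<Sum>t\<le>h. Stirling h t * fact (Suc t) * (w choose Suc t)) + (\<Sum>t\<le>h. g t)"
    unfolding step by (simp add: g_def sum.distrib[symmetric] algebra_simps del: fact_Suc)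
  also have "\<dots> = (\<Sum>t\<le>h. Stirling (Suc h) (Suc t) * fact (Suc t) * (w choose Suc t))"
    unfolding shift[symmetric] sum.distrib[symmetric]
    by (simp add: g_def algebra_simps del: fact_Suc)
  also have "\<dots> = (\<Sum>t\<le>Suc h. Stirling (Suc h) t * fact t * (w choose t))"
    by (subst sum.atMost_Suc_shift) (simp del: sum.atMost_Suc fact_Suc Stirling.simps(4))
  finally show ?case .
qed simp

section \<open>Ternary words, codewords and their weights\<close>

definition words :: "nat \<Rightarrow> (nat \<Rightarrow> 'a::field) set" where
  "words N = ({..<N} \<rightarrow>\<^sub>E {0, 1, - 1})"

definition word_weight :: "nat \<Rightarrow> (nat \<Rightarrow> 'a::zero) \<Rightarrow> nat" where
  "word_weight N u = card {i \<in> {..<N}. u i \<noteq> 0}"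

definition codewords :: "nat \<Rightarrow> (nat \<Rightarrow> 'a::field) \<Rightarrow> (nat \<Rightarrow> 'a) set" where
  "codewords N v = {u \<in> words N. (\<Sum>i<N. u i * v i) = 0}"

definition num_codewords :: "nat \<Rightarrow> (nat \<Rightarrow> 'a::field) \<Rightarrow> nat \<Rightarrow> nat" where
  "num_codewords N v j = card {u \<in> codewords N v. word_weight N u = j}"

text \<open>The double sum common to both parts of the theorem, with weight distribution and length
  as parameters.\<close>

definition moment_sum :: "(nat \<Rightarrow> nat) \<Rightarrow> nat \<Rightarrow> nat \<Rightarrow> complex" where
  "moment_sum C N h = (\<Sum>j=0..min N h. (-1) ^ (h + j) * of_nat (C j) *
     (\<Sum>t=j..h. fact t * of_nat (Stirling h t) * 3 ^ (h - t) *
        2 powi (int t - int h - int j - 1) *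
        of_nat (if t \<le> N then (N - j) choose (N - t) else 0)))"

lemma finite_words: "finite (words N)"
  unfolding words_def by (rule finite_PiE) auto

lemma finite_codewords: "finite (codewords N v)"
  by (simp add: codewords_def finite_words)

lemma word_weight_le: "word_weight N u \<le> N"
proof -
  have "word_weight N u \<le> card {..<N}" unfolding word_weight_def by (rule card_mono) auto
  then show ?thesis by simp
qed

lemma prod_if_card:
  "finite A \<Longrightarrow> (\<Prod>i\<in>A. if P i then x else y) = x ^ card {i \<in> A. P i} * y ^ (card A - card {i \<in> A. P i})"
  for x y :: "'b::comm_monoid_mult"
proof -
  assume A: "finite A"
  have "card A - card {i \<in> A. P i} = card {i \<in> A. \<not> P i}"
  proof -
    have "{i \<in> A. \<not> P i} = A - {i \<in> A. P i}" by auto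
    then show ?thesis using A by (simp add: card_Diff_subset)
  qed
  moreover have "(\<Prod>i\<in>A. if P i then x else y) = (\<Prod>i\<in>A \<inter> {i. P i}. x) * (\<Prod>i\<in>A \<inter> - {i. P i}. y)"
    using A by (rule prod.If_cases)
  moreover have "A \<inter> {i. P i} = {i \<in> A. P i}" "A \<inter> - {i. P i} = {i \<in> A. \<not> P i}" by auto
  ultimately show ?thesis by simp
qed

section \<open>MacWilliams identity and Pless power moments\<close>

context ternary_field
begin

text \<open>The weight of the word with entries tr (a v_i). Indexing by \<open>a\<close> counts a
  word once for each \<open>a\<close> that produces it.\<close>

definition dual_weight :: "nat \<Rightarrow> (nat \<Rightarrow> 'a) \<Rightarrow> 'a \<Rightarrow> nat" where
  "dual_weight N v a = card {i \<in> {..<N}. field_trace r (a * v i) \<noteq> 0}"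

lemma signs_distinct: "(0::'a) \<noteq> - 1" "- 1 \<noteq> (0::'a)" "- 1 \<noteq> (1::'a)" "(1::'a) \<noteq> - 1"
  using one_neq_minus_one by auto

text \<open>Each coordinate contributes 1 or 1 + X according to its trace, and such a function of
  the trace is a combination of the characters of the prime field. Expanding the product over the
  coordinates gives a sum over all words \<open>u\<close>, and summing over \<open>a\<close> keeps
  those orthogonal to \<open>v\<close>. With 1 + X rather than X as the weight variable, the
  coefficient of X^t is a binomial moment.\<close>

lemma macwilliams:
  "(\<Sum>a\<in>UNIV. [:1, 1:] ^ dual_weight N v a) =
     of_nat q * (\<Sum>u\<in>codewords N v. [:0, - 1/3:] ^ word_weight N u * [:1, 2/3::complex:] ^ (N - word_weight N u))"
proof -
  \<comment> \<open>The Fourier transform on the prime field of the function that is 1 at 0 and 1 +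
    X at 1 and - 1: its value at 0 is (1 + 2 (1 + X)) / 3, at 1 and - 1 it is (1 - (1 + X)) /
    3.\<close>
  define G :: "'a \<Rightarrow> complex poly" where "G s = (if s \<noteq> 0 then [:0, - 1/3:] else [:1, 2/3:])" for s
  have local: "(if field_trace r x \<noteq> 0 then [:1, 1:] else 1) = (\<Sum>s\<in>{0, 1, - 1}. G s * [:add_char r (s * x):])" for x
  proof -
    have "add_char r x + add_char r (- x) = (if field_trace r x \<noteq> 0 then - 1 else 2)"
      using add_char_trace_indicator[of x] by (auto simp: eq_neg_iff_add_eq_0 add_ac split: if_splits)
    then have "- 1 / 3 * add_char r x + - 1 / 3 * add_char r (- x) = (if field_trace r x \<noteq> 0 then 1 / 3 else - 2 / 3)"
      by (simp only: distrib_left[symmetric]) simp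
    then show ?thesis using signs_distinct by (simp add: G_def one_pCons)
  qed
  have word: "(\<Prod>i<N. G (u i)) = [:0, - 1/3:] ^ word_weight N u * [:1, 2/3:] ^ (N - word_weight N u)" for u
    unfolding G_def word_weight_def by (subst prod_if_card) auto
  have const: "(\<Prod>i\<in>A. [:f i:]) = [:\<Prod>i\<in>A. f i:]" for A and f :: "nat \<Rightarrow> complex"
    by (induction A rule: infinite_finite_induct) (simp_all add: one_pCons)
  have "[:1, 1:] ^ dual_weight N v a = (\<Sum>u\<in>words N. (\<Prod>i<N. G (u i)) * [:add_char r (a * (\<Sum>i<N. u i * v i)):])" for a
  proof -
    have "[:1, 1::complex:] ^ dual_weight N v a = (\<Prod>i<N. if field_trace r (a * v i) \<noteq> 0 then [:1, 1:] else 1)"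
      by (subst prod_if_card) (auto simp: dual_weight_def)
    also have "\<dots> = (\<Sum>u\<in>words N. \<Prod>i<N. G (u i) * [:add_char r (u i * (a * v i)):])"
      unfolding local words_def by (rule prod_sum_PiE) auto
    also have "\<dots> = (\<Sum>u\<in>words N. (\<Prod>i<N. G (u i)) * [:add_char r (a * (\<Sum>i<N. u i * v i)):])"
      unfolding prod.distrib const add_char_sum[symmetric] sum_distrib_left
      by (intro sum.cong arg_cong2[of _ _ _ _ "(*)"] refl) (simp add: mult_ac)
    finally show ?thesis .
  qed
  then have "(\<Sum>a\<in>UNIV. [:1, 1:] ^ dual_weight N v a) =
     (\<Sum>u\<in>words N. (\<Prod>i<N. G (u i)) * (\<Sum>a\<in>UNIV. [:add_char r ((\<Sum>i<N. u i * v i) * a):]))"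
    by (simp add: sum.swap[of _ UNIV] sum_distrib_left mult.commute)
  also have "\<dots> = (\<Sum>u\<in>words N. if (\<Sum>i<N. u i * v i) = 0 then of_nat q * (\<Prod>i<N. G (u i)) else 0)"
  proof (rule sum.cong[OF refl])
    fix u :: "nat \<Rightarrow> 'a"
    have "(\<Sum>a\<in>UNIV. [:add_char r ((\<Sum>i<N. u i * v i) * a):]) = [:\<Sum>a\<in>UNIV. add_char r ((\<Sum>i<N. u i * v i) * a):]"
      by (rule poly_eqI) (simp add: coeff_sum coeff_pCons split: nat.split)
    also have "\<dots> = (if (\<Sum>i<N. u i * v i) = 0 then of_nat q else 0)"
      by (simp add: sum_add_char of_nat_poly)
    finally show "(\<Prod>i<N. G (u i)) * (\<Sum>a\<in>UNIV. [:add_char r ((\<Sum>i<N. u i * v i) * a):]) =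
      (if (\<Sum>i<N. u i * v i) = 0 then of_nat q * (\<Prod>i<N. G (u i)) else 0)" by simp
  qed
  also have "\<dots> = (\<Sum>u\<in>codewords N v. of_nat q * (\<Prod>i<N. G (u i)))"
    unfolding codewords_def by (rule sum.inter_filter[symmetric, OF finite_words])
  finally show ?thesis by (simp add: word sum_distrib_left)
qed

text \<open>Compares coefficients of X^t in \<open>macwilliams\<close>; a codeword of weight j
  brings the factor X^j, so only j \<le> t contributes.\<close>

lemma sum_choose_dual_weight:
  "(\<Sum>a\<in>UNIV. of_nat (dual_weight N v a choose t)) =
     of_nat q * (\<Sum>j\<le>min N t. of_nat (num_codewords N v j) * (- 1/3) ^ j * (2/3::complex) ^ (t - j) * of_nat ((N - j) choose (t - j)))"
proof -
  have c1: "coeff ([:1, 1::complex:] ^ n) t = of_nat (n choose t)" for n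
  proof (cases "t \<le> n")
    case False
    then have "degree ([:1, 1::complex:] ^ n) < t" by (simp add: degree_power_eq)
    then show ?thesis using False by (simp add: coeff_eq_0 binomial_eq_0)
  qed (simp add: coeff_linear_poly_power)
  define g where "g j = (if j \<le> min N t then (- 1/3) ^ j * (2/3::complex) ^ (t - j) * of_nat ((N - j) choose (t - j)) else 0)" for j
  have c2: "coeff ([:0, - 1/3:] ^ j * [:1, 2/3::complex:] ^ (N - j)) t = g j" if "j \<le> N" for j
  proof -
    have "[:0, - 1/3:] = monom (- 1/3 :: complex) 1" by (simp add: monom_altdef)
    then have "coeff ([:0, - 1/3:] ^ j * [:1, 2/3::complex:] ^ (N - j)) t =
      (if j \<le> t then (- 1/3) ^ j * coeff ([:1, 2/3:] ^ (N - j)) (t - j) else 0)"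
      by (simp add: monom_power coeff_monom_mult)
    also have "\<dots> = g j"
    proof (cases "t - j \<le> N - j")
      case True
      then show ?thesis using that by (simp add: coeff_linear_poly_power g_def)
    next
      case False
      then have "degree ([:1, 2/3::complex:] ^ (N - j)) < t - j" by (simp add: degree_power_eq)
      then show ?thesis using False by (simp add: coeff_eq_0 binomial_eq_0 g_def)
    qed
    finally show ?thesis .
  qed
  have "(\<Sum>a\<in>UNIV. of_nat (dual_weight N v a choose t)) = coeff (\<Sum>a\<in>UNIV. [:1, 1::complex:] ^ dual_weight N v a) t"
    by (simp add: coeff_sum c1)
  also have "\<dots> = of_nat q * (\<Sum>u\<in>codewords N v. g (word_weight N u))"
  proof -
    have "coeff (of_nat q * P) t = of_nat q * coeff P t" for P :: "complex poly"
      by (simp add: of_nat_poly)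
    then show ?thesis
      unfolding macwilliams by (simp only: coeff_sum c2 word_weight_le cong: sum.cong)
  qed
  also have "(\<Sum>u\<in>codewords N v. g (word_weight N u)) =
      (\<Sum>j\<le>N. \<Sum>u\<in>{u\<in>codewords N v. word_weight N u = j}. g (word_weight N u))"
    by (rule sum.group[symmetric]) (auto simp: finite_codewords word_weight_le)
  also have "\<dots> = (\<Sum>j\<le>N. of_nat (num_codewords N v j) * g j)"
    by (simp add: num_codewords_def)
  also have "\<dots> = (\<Sum>j\<le>min N t. of_nat (num_codewords N v j) * g j)"
    by (rule sum.mono_neutral_right) (auto simp: g_def)
  also have "\<dots> = (\<Sum>j\<le>min N t. of_nat (num_codewords N v j) * (- 1/3) ^ j * (2/3::complex) ^ (t - j) * of_nat ((N - j) choose (t - j)))"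
    by (rule sum.cong) (auto simp: g_def)
  finally show ?thesis .
qed

text \<open>Separates the factor 2 (- 2/3)^h, which does not depend on j and t. Its part (2/3)^h is
  the scale of the weights 2/3 (N - G a) and its 2 matches the two square roots of a square, so both
  cancel in \<open>moment_recursion\<close>.\<close>

lemma moment_summand:
  fixes j t h :: nat
  assumes "j \<le> t" "t \<le> h"
  shows "(- 1/3 :: complex) ^ j * (2/3) ^ (t - j) =
    2 * (- 2/3) ^ h * ((-1) ^ (h + j) * (3 ^ (h - t) * 2 powi (int t - int h - int j - 1)))"
proof -
  obtain a where a: "t = j + a" using assms le_Suc_ex by blast
  obtain b where b: "h = t + b" using assms le_Suc_ex by blast
  have e: "int t - int h - int j - 1 = int t - int (h + j + 1)" by simp
  have p: "(2::complex) powi (int t - int h - int j - 1) = 2 ^ t / 2 ^ (h + j + 1)"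
    unfolding e by (subst power_int_diff) (simp_all only: power_int_of_nat zero_neq_numeral[symmetric] not_False_eq_True simp_thms)
  have gen: "2 * (x * (H2 / H3)) * (y * (B3 * (T2 / (H2 * J2 * 2)))) = (x * y) * ((T2 / J2) * (B3 / H3))"
    if "H2 \<noteq> 0" for x y H2 H3 B3 T2 J2 :: complex using that by (simp add: field_simps)
  have s: "(- 1 :: complex) ^ h * (- 1) ^ (h + j) = (- 1) ^ j"
    by (simp add: power_add)
  have m: "(- 2/3 :: complex) ^ h = (- 1) ^ h * (2 ^ h / 3 ^ h)"
    by (simp only: power_minus[of "2/3"] minus_divide_left[symmetric] power_divide)
  have "(2 ^ t / 2 ^ j) * (3 ^ (h - t) / 3 ^ h) = (2 ^ a :: complex) / 3 ^ j / 3 ^ a"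
    unfolding a b by (simp add: power_add)
  moreover have "(- 1/3 :: complex) ^ j * (2/3) ^ (t - j) = (- 1) ^ j * (2 ^ a / 3 ^ j / 3 ^ a)"
    unfolding a power_divide by simp
  ultimately show ?thesis
    unfolding p m power_add power_one_right by (subst gen) (simp_all add: s[unfolded power_add])
qed

lemma dual_weight_moment:
  "(\<Sum>a\<in>UNIV. of_nat (dual_weight N v a) ^ h) = of_nat q * (2 * (- 2/3) ^ h * moment_sum (num_codewords N v) N h)"
proof -
  let ?C = "num_codewords N v"
  define f where "f t j = of_nat (Stirling h t * fact t) * (of_nat (?C j) * (- 1/3) ^ j * (2/3::complex) ^ (t - j) * of_nat ((N - j) choose (t - j)))" for t j
  define s where "s j t = fact t * of_nat (Stirling h t) * 3 ^ (h - t) * (2::complex) powi (int t - int h - int j - 1) *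
        of_nat (if t \<le> N then (N - j) choose (N - t) else 0)" for j t
  define c where "c = 2 * (- 2/3 :: complex) ^ h"
  have summand: "f t j = c * ((-1) ^ (h + j) * of_nat (?C j) * s j t)"
    if "j \<le> N" "j \<le> t" "t \<le> h" for t j
  proof -
    \<comment> \<open>For t > N the truncated difference N - t is 0 and would give a binomial equal
      to 1, hence the explicit case distinction.\<close>
    have b: "(N - j) choose (t - j) = (if t \<le> N then (N - j) choose (N - t) else 0)"
      using that binomial_symmetric[of "t - j" "N - j"] by (auto simp: binomial_eq_0)
    have "f t j = fact t * of_nat (Stirling h t) * of_nat (?C j) * of_nat ((N - j) choose (t - j)) *
        ((- 1/3) ^ j * (2/3::complex) ^ (t - j))"
      unfolding f_def by (simp only: of_nat_mult of_nat_fact mult_ac)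
    then show ?thesis
      unfolding moment_summand[OF that(2,3)] b s_def c_def by (simp only: mult_ac)
  qed
  have "(\<Sum>a\<in>UNIV. of_nat (dual_weight N v a) ^ h) =
      (\<Sum>a\<in>UNIV. \<Sum>t\<le>h. of_nat (Stirling h t * fact t) * of_nat (dual_weight N v a choose t) :: complex)"
    unfolding of_nat_power[symmetric] power_eq_Stirling_sum of_nat_sum of_nat_mult[symmetric] ..
  also have "\<dots> = (\<Sum>t\<le>h. of_nat (Stirling h t * fact t) * (\<Sum>a\<in>UNIV. of_nat (dual_weight N v a choose t)))"
    unfolding sum_distrib_left by (rule sum.swap)
  also have "\<dots> = (\<Sum>t\<le>h. of_nat q * (\<Sum>j\<le>min N t. f t j))"
    unfolding sum_choose_dual_weight f_def sum_distrib_left[of "of_nat (Stirling h _ * fact _)", symmetric]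
    by (simp only: mult.left_commute)
  also have "\<dots> = of_nat q * (\<Sum>t\<le>h. \<Sum>j\<le>min N t. f t j)"
    unfolding sum_distrib_left ..
  also have "(\<Sum>t\<le>h. \<Sum>j\<le>min N t. f t j) = (\<Sum>j\<le>min N h. \<Sum>t=j..h. f t j)"
    unfolding sum.Sigma[OF finite_atMost ballI[OF finite_atMost]] sum.Sigma[OF finite_atMost ballI[OF finite_atLeastAtMost]]
    by (rule sum.reindex_bij_witness[of _ "\<lambda>(j, t). (t, j)" "\<lambda>(t, j). (j, t)"]) auto
  also have "\<dots> = (\<Sum>j\<le>min N h. \<Sum>t=j..h. c * ((-1) ^ (h + j) * of_nat (?C j) * s j t))"
    by (intro sum.cong refl summand) auto
  also have "\<dots> = c * moment_sum ?C N h"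
    unfolding moment_sum_def s_def[symmetric] sum_distrib_left atLeast0AtMost ..
  finally show ?thesis unfolding c_def .
qed

end

section \<open>Weight distributions of ternary codes\<close>

text \<open>Choose the \<open>a\<close> positions first and the \<open>b\<close> positions among the
  rest. For a + b > n one of the two binomials vanishes, in accordance with the default 0.\<close>

lemma trinomial_eq_binomials: "trinomial n a b = (n choose a) * ((n - a) choose b)"
proof (cases "a + b \<le> n")
  case True
  have "fact n = fact a * (fact b * fact (n - a - b) * ((n - a) choose b)) * (n choose a)"
    using binomial_fact_lemma[of a n] binomial_fact_lemma[of b "n - a"] True by simp
  also have "\<dots> = (fact a * fact b * fact (n - a - b)) * ((n choose a) * ((n - a) choose b))"
    by (simp only: mult_ac)
  finally have "fact n div (fact a * fact b * fact (n - a - b)) = (n choose a) * ((n - a) choose b)"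
    by (metis fact_nonzero mult_eq_0_iff nonzero_mult_div_cancel_left)
  then show ?thesis using True by (simp add: trinomial_def)
next
  case False
  then show ?thesis by (cases "a \<le> n") (auto simp: trinomial_def binomial_eq_0)
qed

lemma sum_vimage_card:
  fixes g :: "'b::finite \<Rightarrow> 'c::comm_semiring_1"
  assumes "finite A"
  shows "(\<Sum>i\<in>A. g (f i)) = (\<Sum>\<beta>\<in>UNIV. of_nat (card {i\<in>A. f i = \<beta>}) * g \<beta>)"
proof -
  have "(\<Sum>i\<in>A. g (f i)) = (\<Sum>\<beta>\<in>UNIV. \<Sum>i\<in>{i\<in>A. f i = \<beta>}. g (f i))"
    by (rule sum.group[symmetric]) (use assms in auto)
  then show ?thesis by simp
qed

lemma finite_weight_families: "finite (weight_families j :: (('a::{field,finite} \<Rightarrow> nat) \<times> ('a \<Rightarrow> nat)) set)"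
proof (rule finite_subset)
  let ?F = "UNIV \<rightarrow>\<^sub>E {..j} :: ('a \<Rightarrow> nat) set"
  have *: "\<nu> \<in> ?F" "\<mu> \<in> ?F" if "sum \<nu> UNIV + sum \<mu> UNIV = j" for \<nu> \<mu> :: "'a \<Rightarrow> nat"
  proof -
    have "\<nu> x \<le> sum \<nu> UNIV" "\<mu> x \<le> sum \<mu> UNIV" for x by (simp_all add: member_le_sum)
    then have "\<nu> x \<le> j" "\<mu> x \<le> j" for x using that by (meson trans_le_add1 trans_le_add2 order_eq_refl le_trans)+
    then show "\<nu> \<in> ?F" "\<mu> \<in> ?F" by auto
  qed
  show "weight_families j \<subseteq> ?F \<times> ?F"
  proof
    fix p :: "('a \<Rightarrow> nat) \<times> ('a \<Rightarrow> nat)" assume "p \<in> weight_families j"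
    then show "p \<in> ?F \<times> ?F"
      using *[of "fst p" "snd p"] by (simp only: weight_families_def mem_Times_iff split_def mem_Collect_eq)
  qed
  show "finite (?F \<times> ?F)" by (intro finite_cartesian_product finite_PiE) auto
qed

section \<open>Counting ternary words by their sign counts\<close>

context ternary_field
begin

definition signs :: "'a set" where "signs = {0, 1, - 1}"

text \<open>A function into the signs is determined by the disjoint sets on which it is 1 and - 1;
  choosing these one after the other gives the two binomials.\<close>

lemma card_sign_functions:
  assumes A: "finite A"
  shows "card {f \<in> A \<rightarrow>\<^sub>E signs. card {i \<in> A. f i = 1} = a \<and> card {i \<in> A. f i = - 1} = b} = trinomial (card A) a b"
    (is "card ?L = _")
proof -
  let ?R = "Sigma {P. P \<subseteq> A \<and> card P = a} (\<lambda>P. {M. M \<subseteq> A - P \<and> card M = b})"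
  let ?f = "\<lambda>f. ({i \<in> A. f i = 1}, {i \<in> A. f i = (- 1 :: 'a)})"
  let ?g = "\<lambda>(P, M). restrict (\<lambda>i. if i \<in> P then 1 else if i \<in> M then - 1 else (0::'a)) A"
  have "bij_betw ?f ?L ?R"
  proof (rule bij_betw_byWitness[where f' = ?g])
    show "\<forall>f\<in>?L. ?g (?f f) = f"
      by (auto simp: fun_eq_iff restrict_def PiE_iff extensional_def signs_def; blast)
    have "{i \<in> A. (?g (P, M)) i = 1} = P" "{i \<in> A. (?g (P, M)) i = - 1} = M"
      if "P \<subseteq> A" "M \<subseteq> A - P" for P M
      using that by (auto simp: signs_distinct split: if_splits)
    then show "\<forall>x\<in>?R. ?f (?g x) = x" and "?g ` ?R \<subseteq> ?L"
      by (force simp: signs_def)+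
    show "?f ` ?L \<subseteq> ?R" by (auto simp: signs_distinct)
  qed
  then have "card ?L = card ?R" by (rule bij_betw_same_card)
  also have "\<dots> = (\<Sum>P | P \<subseteq> A \<and> card P = a. card {M. M \<subseteq> A - P \<and> card M = b})"
    using A by (intro card_SigmaI) auto
  also have "\<dots> = (\<Sum>P | P \<subseteq> A \<and> card P = a. (card A - a) choose b)"
    using A by (intro sum.cong refl) (auto simp: n_subsets card_Diff_subset finite_subset)
  also have "\<dots> = trinomial (card A) a b"
    using A by (simp add: trinomial_eq_binomials n_subsets)
  finally show ?thesis .
qed

text \<open>Each condition concerns a single fibre of \<open>v\<close>, so a word splits into
  independent restrictions to the fibres.\<close>

lemma card_words_with_counts:
  fixes v :: "'i \<Rightarrow> 'a"
  assumes I: "finite I"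
  shows "card {u \<in> I \<rightarrow>\<^sub>E signs. \<forall>\<beta>. card {i \<in> I. v i = \<beta> \<and> u i = 1} = \<nu> \<beta> \<and> card {i \<in> I. v i = \<beta> \<and> u i = - 1} = \<mu> \<beta>}
    = (\<Prod>\<beta>\<in>UNIV. trinomial (card {i \<in> I. v i = \<beta>}) (\<nu> \<beta>) (\<mu> \<beta>))" (is "card ?L = _")
proof -
  define F where "F \<beta> = {i \<in> I. v i = \<beta>}" for \<beta>
  define R where "R \<beta> = {f \<in> F \<beta> \<rightarrow>\<^sub>E signs. card {i \<in> F \<beta>. f i = 1} = \<nu> \<beta> \<and> card {i \<in> F \<beta>. f i = - 1} = \<mu> \<beta>}" for \<beta>
  let ?f = "\<lambda>u \<beta>. restrict u (F \<beta>)"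
  let ?g = "\<lambda>g. restrict (\<lambda>i. g (v i) i) I"
  have eq: "{i \<in> F \<beta>. restrict u (F \<beta>) i = s} = {i \<in> I. v i = \<beta> \<and> u i = s}" for u \<beta> s
    by (auto simp: F_def)
  have eq': "{i \<in> I. v i = \<beta> \<and> (if i \<in> I then g (v i) i else undefined) = s} = {i \<in> F \<beta>. g \<beta> i = s}" for g \<beta> s
    by (auto simp: F_def)
  have "bij_betw ?f ?L (PiE UNIV R)"
  proof (rule bij_betw_byWitness[where f' = ?g])
    show "\<forall>u\<in>?L. ?g (?f u) = u"
      by (auto simp: fun_eq_iff restrict_def PiE_iff extensional_def F_def)
    show "\<forall>g\<in>PiE UNIV R. ?f (?g g) = g"
      by (auto simp: fun_eq_iff restrict_def PiE_iff extensional_def F_def R_def)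
    show "?f ` ?L \<subseteq> PiE UNIV R"
      unfolding R_def by (auto simp only: eq mem_Collect_eq PiE_iff extensional_UNIV) (auto simp: F_def)
    show "?g ` PiE UNIV R \<subseteq> ?L"
    proof (clarsimp simp: restrict_def eq', intro conjI allI)
      fix g assume g: "g \<in> PiE UNIV R"
      show "(\<lambda>x. if x \<in> I then g (v x) x else undefined) \<in> I \<rightarrow>\<^sub>E signs"
        using g by (fastforce simp: R_def F_def PiE_iff extensional_def)
      show "card {i \<in> F \<beta>. g \<beta> i = 1} = \<nu> \<beta>" "card {i \<in> F \<beta>. g \<beta> i = - 1} = \<mu> \<beta>" for \<beta>
        using g by (auto simp: R_def PiE_iff)
    qed
  qed
  then have "card ?L = (\<Prod>\<beta>\<in>UNIV. card (R \<beta>))"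
    by (simp add: bij_betw_same_card card_PiE)
  also have "\<dots> = (\<Prod>\<beta>\<in>UNIV. trinomial (card (F \<beta>)) (\<nu> \<beta>) (\<mu> \<beta>))"
    unfolding R_def using I by (intro prod.cong refl card_sign_functions) (simp add: F_def)
  finally show ?thesis by (simp add: F_def)
qed

text \<open>Weight and inner product with \<open>v\<close> depend on \<open>u\<close> only through
  the numbers of entries 1 and - 1 on each fibre of \<open>v\<close>. These numbers are the families
  \<open>\<nu>\<close> and \<open>\<mu>\<close>; grouping the codewords by them leaves products of
  trinomials.\<close>

lemma num_codewords_eq:
  fixes v :: "nat \<Rightarrow> 'a"
  shows "num_codewords N v j = (\<Sum>(\<nu>, \<mu>)\<in>weight_families j.
    \<Prod>\<beta>\<in>UNIV. trinomial (card {i \<in> {..<N}. v i = \<beta>}) (\<nu> \<beta>) (\<mu> \<beta>))"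
proof -
  define c where "c u = ((\<lambda>\<beta>. card {i \<in> {..<N}. v i = \<beta> \<and> u i = (1::'a)}), (\<lambda>\<beta>. card {i \<in> {..<N}. v i = \<beta> \<and> u i = - 1}))" for u
  have *: "u \<in> codewords N v \<and> word_weight N u = j \<longleftrightarrow> u \<in> words N \<and> c u \<in> weight_families j" for u
  proof (cases "u \<in> words N")
    case True
    then have u: "u i \<in> {0, 1, - 1}" if "i < N" for i using that by (auto simp: words_def PiE_iff)
    let ?A = "\<lambda>s. {i \<in> {..<N}. u i = s}"
    have AA: "{i \<in> ?A s. v i = \<beta>} = {i \<in> {..<N}. v i = \<beta> \<and> u i = s}" for s \<beta> by auto
    have cA: "card (?A s) = (\<Sum>\<beta>\<in>UNIV. card {i \<in> {..<N}. v i = \<beta> \<and> u i = s})" for s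
      using sum_vimage_card[of "?A s" "\<lambda>_. 1::nat" v] unfolding AA by simp
    have sA: "(\<Sum>i\<in>?A s. v i) = (\<Sum>\<beta>\<in>UNIV. of_nat (card {i \<in> {..<N}. v i = \<beta> \<and> u i = s}) * \<beta>)" for s
      using sum_vimage_card[of "?A s" "\<lambda>x. x" v] unfolding AA by simp
    have "{i \<in> {..<N}. u i \<noteq> 0} = ?A 1 \<union> ?A (- 1)" using u signs_distinct by fastforce
    moreover have "?A 1 \<inter> ?A (- 1) = {}" using signs_distinct by fastforce
    ultimately have "word_weight N u = card (?A 1) + card (?A (- 1))"
      unfolding word_weight_def by (simp add: card_Un_disjoint)
    then have w: "word_weight N u = (\<Sum>\<beta>\<in>UNIV. fst (c u) \<beta>) + (\<Sum>\<beta>\<in>UNIV. snd (c u) \<beta>)"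
      unfolding cA by (simp add: c_def)
    have "(\<Sum>i<N. u i * v i) = (\<Sum>i<N. (if u i = 1 then v i else 0) - (if u i = - 1 then v i else 0))"
      using u signs_distinct by (intro sum.cong refl) fastforce
    also have "\<dots> = (\<Sum>i\<in>?A 1. v i) - (\<Sum>i\<in>?A (- 1). v i)"
      by (simp only: sum_subtractf sum.inter_filter finite_lessThan)
    also have "\<dots> = (\<Sum>\<beta>\<in>UNIV. of_nat (fst (c u) \<beta>) * \<beta>) - (\<Sum>\<beta>\<in>UNIV. of_nat (snd (c u) \<beta>) * \<beta>)"
      unfolding sA by (simp add: c_def)
    finally have "(\<Sum>i<N. u i * v i) = \<dots>" .
    then show ?thesis using True w by (auto simp: codewords_def weight_families_def split_def)
  qed (simp add: codewords_def)
  have "num_codewords N v j = (\<Sum>u\<in>{u \<in> words N. c u \<in> weight_families j}. 1)"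
    by (simp add: num_codewords_def *)
  also have "\<dots> = (\<Sum>p\<in>weight_families j. \<Sum>u\<in>{u \<in> {u \<in> words N. c u \<in> weight_families j}. c u = p}. 1)"
    by (rule sum.group[symmetric]) (auto simp: finite_weight_families finite_words)
  also have "\<dots> = (\<Sum>p\<in>weight_families j. \<Prod>\<beta>\<in>UNIV. trinomial (card {i \<in> {..<N}. v i = \<beta>}) (fst p \<beta>) (snd p \<beta>))"
  proof (rule sum.cong[OF refl])
    fix p :: "('a \<Rightarrow> nat) \<times> ('a \<Rightarrow> nat)" assume "p \<in> weight_families j"
    then have "{u \<in> {u \<in> words N. c u \<in> weight_families j}. c u = p} = {u \<in> {..<N} \<rightarrow>\<^sub>E signs.
        \<forall>\<beta>. card {i \<in> {..<N}. v i = \<beta> \<and> u i = 1} = fst p \<beta> \<and> card {i \<in> {..<N}. v i = \<beta> \<and> u i = - 1} = snd p \<beta>}"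
      by (cases p) (auto simp: c_def words_def signs_def fun_eq_iff)
    then show "(\<Sum>u\<in>{u \<in> {u \<in> words N. c u \<in> weight_families j}. c u = p}. 1) =
      (\<Prod>\<beta>\<in>UNIV. trinomial (card {i \<in> {..<N}. v i = \<beta>}) (fst p \<beta>) (snd p \<beta>))"
      using card_words_with_counts[of "{..<N}" v "fst p" "snd p"] by simp
  qed
  finally show ?thesis by (simp add: split_def)
qed

lemma prime_subfield_eq: "(prime_subfield :: 'a set) = {0, 1, - 1}"
proof -
  have *: "of_int n \<in> {0, 1, - 1 :: 'a}" for n
  proof -
    have "(of_int n :: 'a) = of_int (3 * (n div 3) + n mod 3)" by simp
    also have "\<dots> = of_int (n mod 3)" unfolding of_int_add of_int_mult by (simp add: three_eq_0)
    finally have "(of_int n :: 'a) = of_int (n mod 3)" .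
    moreover have "n mod 3 = 0 \<or> n mod 3 = 1 \<or> n mod 3 = 2" by presburger
    ultimately show ?thesis by (elim disjE) (simp_all only: two_eq of_int_0 of_int_1 of_int_numeral insert_iff simp_thms)
  qed
  have "x \<in> prime_subfield" if "x \<in> {0, 1, - 1 :: 'a}" for x
  proof -
    have "x = of_int 0 \<or> x = of_int 1 \<or> x = of_int (- 1)" using that by auto
    then show ?thesis by (elim disjE) (simp_all only: prime_subfield_def rangeI)
  qed
  moreover have "(prime_subfield :: 'a set) \<subseteq> {0, 1, - 1}"
    unfolding prime_subfield_def using * by (rule image_subsetI)
  ultimately show ?thesis by (intro equalityI) (assumption, rule subsetI)
qed

text \<open>Passes from vectors to extensional functions on the index set, the form in which words
  are counted above.\<close>

lemma weight_distribution_trace_code: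
  fixes gs :: "'a mat list"
  shows "weight_distribution (trace_code gs) j = num_codewords (length gs) (\<lambda>i. mat_trace (gs ! i)) j"
proof -
  let ?N = "length gs"
  have w: "word_weight ?N (restrict (($) u) {..<?N}) = hamming_weight u" if "dim_vec u = ?N" for u :: "'a vec"
  proof -
    have "{i \<in> {..<?N}. restrict (($) u) {..<?N} i \<noteq> 0} = {i. i < dim_vec u \<and> u $ i \<noteq> 0}"
      using that by auto
    then show ?thesis by (simp add: word_weight_def hamming_weight_def)
  qed
  have s: "u \<bullet> map_vec mat_trace (vec_of_list gs) = (\<Sum>i<?N. u $ i * mat_trace (gs ! i))" for u :: "'a vec"
    by (simp add: scalar_prod_def vec_of_list_index atLeast0LessThan)
  have "bij_betw (\<lambda>u. restrict (($) u) {..<?N}) {u \<in> trace_code gs. hamming_weight u = j}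
     {u \<in> codewords ?N (\<lambda>i. mat_trace (gs ! i)). word_weight ?N u = j}"
  proof (rule bij_betw_byWitness[where f' = "vec ?N"])
    show "\<forall>u\<in>{u \<in> trace_code gs. hamming_weight u = j}. vec ?N (restrict (($) u) {..<?N}) = u"
      by (auto simp: trace_code_def intro!: eq_vecI)
    show "\<forall>u\<in>{u \<in> codewords ?N (\<lambda>i. mat_trace (gs ! i)). word_weight ?N u = j}.
        restrict (($) (vec ?N u)) {..<?N} = u"
      by (auto simp: codewords_def words_def fun_eq_iff PiE_iff extensional_def restrict_def)
    show "(\<lambda>u. restrict (($) u) {..<?N}) ` {u \<in> trace_code gs. hamming_weight u = j}
        \<subseteq> {u \<in> codewords ?N (\<lambda>i. mat_trace (gs ! i)). word_weight ?N u = j}"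
      by (auto simp: w trace_code_def codewords_def words_def prime_subfield_eq s restrict_PiE_iff split: if_splits)
    show "vec ?N ` {u \<in> codewords ?N (\<lambda>i. mat_trace (gs ! i)). word_weight ?N u = j}
        \<subseteq> {u \<in> trace_code gs. hamming_weight u = j}"
    proof (clarsimp, intro conjI)
      fix u assume u: "u \<in> codewords ?N (\<lambda>i. mat_trace (gs ! i))"
      then show "vec ?N u \<in> trace_code gs"
        by (auto simp: trace_code_def codewords_def words_def prime_subfield_eq s PiE_iff)
      have "{i. i < ?N \<and> vec ?N u $ i \<noteq> 0} = {i \<in> {..<?N}. u i \<noteq> 0}" by auto
      then show "hamming_weight (vec ?N u) = word_weight ?N u"
        by (simp add: word_weight_def hamming_weight_def)
    qed
  qed
  then show ?thesis
    unfolding weight_distribution_def num_codewords_def by (rule bij_betw_same_card)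
qed

end

section \<open>Symplectic matrices\<close>

lemma symplectic_form_carrier: "symplectic_form n \<in> carrier_mat (2 * n) (2 * n)"
  unfolding symplectic_form_def mult_2 by (rule four_block_carrier_mat) auto

lemma symplectic_form_index:
  assumes "i < 2 * n" "j < 2 * n"
  shows "(symplectic_form n :: 'b::field mat) $$ (i, j) =
    (if j = i + n then 1 else if i = j + n then - 1 else 0)"
  using assms by (auto simp: symplectic_form_def)

lemma symplectic_form_mult_index:
  fixes w :: "'b::field mat"
  assumes w: "w \<in> carrier_mat (2 * n) (2 * n)" and i: "i < 2 * n" and j: "j < 2 * n"
  shows "(symplectic_form n * w) $$ (i, j) = (if i < n then w $$ (i + n, j) else - w $$ (i - n, j))"
proof -
  let ?J = "symplectic_form n :: 'b mat"
  have "(?J * w) $$ (i, j) = (\<Sum>k<2 * n. ?J $$ (i, k) * w $$ (k, j))"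
    using w i j symplectic_form_carrier[of n, where 'a = 'b]
    by (simp add: scalar_prod_def atLeast0LessThan)
  also have "\<dots> = (\<Sum>k<2 * n. if k = (if i < n then i + n else i - n)
      then (if i < n then w $$ (i + n, j) else - w $$ (i - n, j)) else 0)"
    using i by (intro sum.cong refl) (auto simp: symplectic_form_index)
  also have "\<dots> = (if i < n then w $$ (i + n, j) else - w $$ (i - n, j))"
    using i by (subst sum.delta) auto
  finally show ?thesis .
qed

text \<open>The symplectic form evaluated on columns i and j of \<open>w\<close>.\<close>

definition symplectic_product :: "nat \<Rightarrow> 'b::field mat \<Rightarrow> nat \<Rightarrow> nat \<Rightarrow> 'b" where
  "symplectic_product n w i j = (\<Sum>k<n. w $$ (k, i) * w $$ (k + n, j) - w $$ (k + n, i) * w $$ (k, j))"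

lemma transpose_symplectic_form_index:
  fixes w :: "'b::field mat"
  assumes w: "w \<in> carrier_mat (2 * n) (2 * n)" and i: "i < 2 * n" and j: "j < 2 * n"
  shows "(transpose_mat w * symplectic_form n * w) $$ (i, j) = symplectic_product n w i j"
proof -
  let ?J = "symplectic_form n :: 'b mat"
  have J: "?J \<in> carrier_mat (2 * n) (2 * n)" by (rule symplectic_form_carrier)
  have "transpose_mat w * ?J * w = transpose_mat w * (?J * w)"
    using w J by (intro assoc_mult_mat) auto
  moreover have "(transpose_mat w * X) $$ (i, j) = (\<Sum>k<2 * n. w $$ (k, i) * X $$ (k, j))"
    if "X \<in> carrier_mat (2 * n) (2 * n)" for X
    using w i j that by (simp add: scalar_prod_def atLeast0LessThan)
  ultimately have "(transpose_mat w * ?J * w) $$ (i, j) = (\<Sum>k<2 * n. w $$ (k, i) * (?J * w) $$ (k, j))"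
    using w J by simp
  also have "\<dots> = (\<Sum>k<2 * n. w $$ (k, i) * (if k < n then w $$ (k + n, j) else - w $$ (k - n, j)))"
    using w j by (intro sum.cong refl) (simp add: symplectic_form_mult_index del: index_mult_mat(1))
  also have "\<dots> = (\<Sum>k<n. w $$ (k, i) * w $$ (k + n, j)) + (\<Sum>k=n..<2 * n. w $$ (k, i) * - w $$ (k - n, j))"
    by (subst atLeast0LessThan[symmetric], subst sum.atLeastLessThan_concat[symmetric, of 0 n])
      (auto simp: atLeast0LessThan intro!: arg_cong2[of _ _ _ _ "(+)"] sum.cong)
  also have "(\<Sum>k=n..<2 * n. w $$ (k, i) * - w $$ (k - n, j)) = (\<Sum>k<n. w $$ (k + n, i) * - w $$ (k, j))"
    by (rule sum.reindex_bij_witness[of _ "\<lambda>k. k + n" "\<lambda>k. k - n"]) auto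
  finally show ?thesis
    by (simp add: symplectic_product_def sum_subtractf sum_negf)
qed

lemma symplectic_form_square: "symplectic_form n * symplectic_form n = - (1\<^sub>m (2 * n) :: 'b::field mat)"
proof (rule eq_matI)
  fix i j assume "i < dim_row (- 1\<^sub>m (2 * n) :: 'b mat)" "j < dim_col (- 1\<^sub>m (2 * n) :: 'b mat)"
  then have ij: "i < 2 * n" "j < 2 * n" by auto
  show "(symplectic_form n * symplectic_form n) $$ (i, j) = (- 1\<^sub>m (2 * n) :: 'b mat) $$ (i, j)"
    using ij symplectic_form_mult_index[OF symplectic_form_carrier ij, where 'b = 'b]
    by (auto simp: symplectic_form_index simp del: index_mult_mat(1))
qed (use symplectic_form_carrier[of n, where 'a = 'b] in auto)

lemma invertible_symplectic:
  fixes w :: "'b::field mat"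
  assumes w: "w \<in> carrier_mat (2 * n) (2 * n)"
    and sp: "transpose_mat w * symplectic_form n * w = symplectic_form n"
  shows "invertible_mat w"
proof -
  let ?J = "symplectic_form n :: 'b mat"
  have J: "?J \<in> carrier_mat (2 * n) (2 * n)" by (rule symplectic_form_carrier)
  \<comment> \<open>From J^2 = - 1 and w^T J w = J, the matrix - J w^T J is a left inverse of
    \<open>w\<close>.\<close>
  define B where "B = - (?J * (transpose_mat w * ?J))"
  have B: "B \<in> carrier_mat (2 * n) (2 * n)" using w J by (simp add: B_def)
  have "B * w = - (?J * (transpose_mat w * ?J) * w)"
    unfolding B_def using w J by simp
  also have "?J * (transpose_mat w * ?J) * w = ?J * (transpose_mat w * ?J * w)"
    using w J by (intro assoc_mult_mat) auto
  also have "- \<dots> = 1\<^sub>m (2 * n)" by (simp add: sp symplectic_form_square)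
  finally have l: "B * w = 1\<^sub>m (2 * n)" .
  then have "w * B = 1\<^sub>m (2 * n)" using mat_mult_left_right_inverse[OF B w] by simp
  then show ?thesis
    using l w B unfolding invertible_mat_def inverts_mat_def by (auto simp: square_mat.simps)
qed

lemma Sp_iff:
  "w \<in> Sp n \<longleftrightarrow> w \<in> carrier_mat (2 * n) (2 * n) \<and>
     (\<forall>i<2 * n. \<forall>j<2 * n. symplectic_product n w i j =
        (if j = i + n then 1 else if i = j + n then - 1 else 0))"
proof -
  have "transpose_mat w * symplectic_form n * w = symplectic_form n \<longleftrightarrow>
     (\<forall>i<2 * n. \<forall>j<2 * n. symplectic_product n w i j =
        (if j = i + n then 1 else if i = j + n then - 1 else 0))"
    if w: "w \<in> carrier_mat (2 * n) (2 * n)"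
  proof -
    have "transpose_mat w * symplectic_form n * w = symplectic_form n \<longleftrightarrow>
      (\<forall>i<2 * n. \<forall>j<2 * n. (transpose_mat w * symplectic_form n * w) $$ (i, j) = symplectic_form n $$ (i, j))"
      using w symplectic_form_carrier[of n, where 'a = 'a] by (auto intro!: eq_matI simp del: index_mult_mat(1))
    then show ?thesis
      using w by (simp add: transpose_symplectic_form_index symplectic_form_index del: index_mult_mat(1) cong: imp_cong)
  qed
  then show ?thesis unfolding Sp_def using invertible_symplectic by blast
qed

section \<open>Elements of Sp(4, q) as quadruples of columns\<close>

type_synonym 'b vec4 = "'b \<times> 'b \<times> 'b \<times> 'b"

text \<open>Columns are plain tuples: these form a finite type, and the symplectic relations become
  polynomial equations in named entries.\<close>

fun form4 :: "'b::field vec4 \<Rightarrow> 'b vec4 \<Rightarrow> 'b" where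
  "form4 (x0, x1, x2, x3) (y0, y1, y2, y3) = x0 * y2 - x2 * y0 + (x1 * y3 - x3 * y1)"

text \<open>The columns of the elements of \<open>Sp 2\<close>.\<close>

definition symplectic_bases :: "('b::field vec4 \<times> 'b vec4 \<times> 'b vec4 \<times> 'b vec4) set" where
  "symplectic_bases = {(u, v, y, z). form4 u y = 1 \<and> form4 v z = 1 \<and> form4 u v = 0 \<and>
     form4 u z = 0 \<and> form4 v y = 0 \<and> form4 y z = 0}"

fun trace4 :: "'b::field vec4 \<times> 'b vec4 \<times> 'b vec4 \<times> 'b vec4 \<Rightarrow> 'b" where
  "trace4 ((u0, _, _, _), (_, v1, _, _), (_, _, y2, _), (_, _, _, z3)) = u0 + v1 + y2 + z3"

fun nth4 :: "'b vec4 \<Rightarrow> nat \<Rightarrow> 'b" where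
  "nth4 (x0, x1, x2, x3) i = (if i = 0 then x0 else if i = 1 then x1 else if i = 2 then x2 else x3)"

definition column4 :: "'b mat \<Rightarrow> nat \<Rightarrow> 'b vec4" where
  "column4 w j = (w $$ (0, j), w $$ (1, j), w $$ (2, j), w $$ (3, j))"

lemma all_less_4: "(\<forall>i<4. P i) \<longleftrightarrow> P 0 \<and> P 1 \<and> P 2 \<and> P (3::nat)"
proof -
  have "i < 4 \<longleftrightarrow> i = 0 \<or> i = 1 \<or> i = 2 \<or> i = 3" for i :: nat by auto
  then show ?thesis by auto
qed

lemma all_less_2: "(\<forall>i<2. P i) \<longleftrightarrow> P 0 \<and> P (1::nat)"
proof -
  have "i < 2 \<longleftrightarrow> i = 0 \<or> i = 1" for i :: nat by auto
  then show ?thesis by auto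
qed

lemma symplectic_product_2: "symplectic_product 2 w i j = form4 (column4 w i) (column4 w j)"
  by (simp add: symplectic_product_def column4_def numeral_2_eq_2 numeral_3_eq_3)

lemma form4_swap: "form4 y x = - form4 x y"
  by (cases x; cases y) (simp add: mult.commute)

lemma form4_self: "form4 x x = 0"
  by (cases x) (simp add: mult.commute)

text \<open>Since the form is alternating, the sixteen relations of \<open>Sp_iff\<close> reduce to
  those for the six pairs of distinct columns.\<close>

lemma Sp_2_iff:
  "w \<in> Sp 2 \<longleftrightarrow> w \<in> carrier_mat 4 4 \<and> (column4 w 0, column4 w 1, column4 w 2, column4 w 3) \<in> symplectic_bases"
proof -
  have "- x = - 1 \<longleftrightarrow> x = 1" for x :: 'a by simp
  then show ?thesis
    unfolding Sp_iff symplectic_product_2 symplectic_bases_def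
    by (simp add: all_less_4 form4_self form4_swap[of "column4 w (Suc 0)" "column4 w 0"]
      form4_swap[of "column4 w 2" "column4 w 0"] form4_swap[of "column4 w 2" "column4 w (Suc 0)"]
      form4_swap[of "column4 w 3" "column4 w 0"] form4_swap[of "column4 w 3" "column4 w (Suc 0)"]
      form4_swap[of "column4 w 3" "column4 w 2"]) auto
qed

lemma mat_trace_4: "w \<in> carrier_mat 4 4 \<Longrightarrow> mat_trace w = trace4 (column4 w 0, column4 w 1, column4 w 2, column4 w 3)"
  by (simp add: mat_trace_def column4_def eval_nat_numeral)

lemma sum_Sp_2:
  fixes F :: "'b::field \<Rightarrow> 'c::comm_monoid_add"
  shows "(\<Sum>g\<in>Sp 2. F (mat_trace g)) = (\<Sum>t\<in>symplectic_bases. F (trace4 t))"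
proof (rule sum.reindex_bij_witness[where
    j = "\<lambda>w. (column4 w 0, column4 w 1, column4 w 2, column4 w 3)" and
    i = "\<lambda>(u, v, y, z). mat 4 4 (\<lambda>(i, j). nth4 (nth4 (u, v, y, z) j) i)"])
  fix w :: "'b mat" assume w: "w \<in> Sp 2"
  then have c: "w \<in> carrier_mat 4 4" by (simp add: Sp_2_iff)
  show "(case (column4 w 0, column4 w 1, column4 w 2, column4 w 3) of (u, v, y, z) \<Rightarrow>
      mat 4 4 (\<lambda>(i, j). nth4 (nth4 (u, v, y, z) j) i)) = w"
  proof (rule eq_matI)
    show "(case (column4 w 0, column4 w 1, column4 w 2, column4 w 3) of (u, v, y, z) \<Rightarrow>
      mat 4 4 (\<lambda>(i, j). nth4 (nth4 (u, v, y, z) j) i)) $$ (i, j) = w $$ (i, j)"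
      if "i < dim_row w" "j < dim_col w" for i j
    proof -
      have "\<forall>i<4. \<forall>j<4. nth4 (nth4 (column4 w 0, column4 w 1, column4 w 2, column4 w 3) j) i = w $$ (i, j)"
        by (simp add: all_less_4 column4_def)
      then show ?thesis using that c by simp
    qed
  qed (use c in auto)
  show "(column4 w 0, column4 w 1, column4 w 2, column4 w 3) \<in> symplectic_bases"
    using w by (simp add: Sp_2_iff)
  show "F (trace4 (column4 w 0, column4 w 1, column4 w 2, column4 w 3)) = F (mat_trace w)"
    using c by (simp only: mat_trace_4)
next
  fix t :: "'b vec4 \<times> 'b vec4 \<times> 'b vec4 \<times> 'b vec4" assume t: "t \<in> symplectic_bases"
  obtain u v y z where uvyz: "t = (u, v, y, z)" by (cases t)
  let ?w = "mat 4 4 (\<lambda>(i, j). nth4 (nth4 (u, v, y, z) j) i)"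
  have "column4 ?w 0 = u" "column4 ?w 1 = v" "column4 ?w 2 = y" "column4 ?w 3 = z"
    by (cases u; cases v; cases y; cases z; simp add: column4_def)+
  then show "(column4 (case t of (u, v, y, z) \<Rightarrow> mat 4 4 (\<lambda>(i, j). nth4 (nth4 (u, v, y, z) j) i)) 0,
      column4 (case t of (u, v, y, z) \<Rightarrow> mat 4 4 (\<lambda>(i, j). nth4 (nth4 (u, v, y, z) j) i)) 1,
      column4 (case t of (u, v, y, z) \<Rightarrow> mat 4 4 (\<lambda>(i, j). nth4 (nth4 (u, v, y, z) j) i)) 2,
      column4 (case t of (u, v, y, z) \<Rightarrow> mat 4 4 (\<lambda>(i, j). nth4 (nth4 (u, v, y, z) j) i)) 3) = t"
    "(case t of (u, v, y, z) \<Rightarrow> mat 4 4 (\<lambda>(i, j). nth4 (nth4 (u, v, y, z) j) i)) \<in> Sp 2"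
    using t by (simp_all add: uvyz Sp_2_iff)
qed

text \<open>In dimension two the form of the two columns is the determinant, so Sp(2, q) is SL(2,
  q).\<close>

lemma Sp_1_iff:
  "w \<in> Sp 1 \<longleftrightarrow> w \<in> carrier_mat 2 2 \<and> w $$ (0, 0) * w $$ (1, 1) - w $$ (0, 1) * w $$ (1, 0) = 1"
proof -
  have "y - x = - 1 \<longleftrightarrow> x - y = 1" for x y :: 'a
    by (metis minus_diff_eq neg_equal_iff_equal)
  then show ?thesis
    unfolding Sp_iff by (simp add: all_less_2 symplectic_product_def mult.commute)
qed

lemma sum_Sp_1:
  fixes F :: "'b::field \<Rightarrow> 'c::comm_monoid_add"
  shows "(\<Sum>g\<in>Sp 1. F (mat_trace g)) = (\<Sum>(x, b, c, y) | x * y - b * c = 1. F (x + y))"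
proof (rule sum.reindex_bij_witness[where
    j = "\<lambda>w. (w $$ (0, 0), w $$ (0, 1), w $$ (1, 0), w $$ (1, 1))" and
    i = "\<lambda>(x, b, c, y). mat 2 2 (\<lambda>(i, j). if i = 0 then if j = 0 then x else b else if j = 0 then c else y)"])
  fix w :: "'b mat" assume w: "w \<in> Sp 1"
  then have c: "w \<in> carrier_mat 2 2" by (simp add: Sp_1_iff[unfolded One_nat_def])
  have "\<forall>i<2. \<forall>j<2. (if i = 0 then if j = 0 then w $$ (0, 0) else w $$ (0, 1)
      else if j = 0 then w $$ (1, 0) else w $$ (1, 1)) = w $$ (i, j)"
    by (simp add: all_less_2)
  then show "(case (w $$ (0, 0), w $$ (0, 1), w $$ (1, 0), w $$ (1, 1)) of (x, b, c, y) \<Rightarrow>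
      mat 2 2 (\<lambda>(i, j). if i = 0 then if j = 0 then x else b else if j = 0 then c else y)) = w"
    using c by (intro eq_matI) (auto simp: less_2_cases_iff)
  show "(case (w $$ (0, 0), w $$ (0, 1), w $$ (1, 0), w $$ (1, 1)) of (x, b, c, y) \<Rightarrow> F (x + y)) = F (mat_trace w)"
    using c by (simp add: mat_trace_def numeral_2_eq_2)
qed (auto simp: Sp_1_iff[unfolded One_nat_def])

section \<open>Counting symplectic bases\<close>

fun shift4 :: "'b::field \<Rightarrow> 'b vec4 \<Rightarrow> 'b vec4 \<Rightarrow> 'b vec4" where
  "shift4 t (e0, e1, e2, e3) (x0, x1, x2, x3) = (x0 + t * e0, x1 + t * e1, x2 + t * e2, x3 + t * e3)"

lemma form4_shift4: "form4 u (shift4 t e x) = form4 u x + t * form4 u e"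
  by (cases u; cases e; cases x) (simp add: algebra_simps)

lemma shift4_inverse: "shift4 (- t) e (shift4 t e x) = x"
  by (cases e; cases x) simp

lemma shift4_inverse': "shift4 t e (shift4 (- t) e x) = x"
  by (cases e; cases x) simp

lemma form4_eq_0_swap: "form4 y x = 0 \<longleftrightarrow> form4 x y = 0"
  using form4_swap[of y x] by simp

lemma form4_dual:
  assumes "u \<noteq> (0, 0, 0, 0)"
  shows "\<exists>e. form4 u e = 1"
proof -
  obtain u0 u1 u2 u3 where u: "u = (u0, u1, u2, u3)" by (cases u)
  from assms consider "u0 \<noteq> 0" | "u1 \<noteq> 0" | "u2 \<noteq> 0" | "u3 \<noteq> 0" by (auto simp: u)
  then show ?thesis
  proof cases
    case 1
    then have "form4 u (0, 0, 1 / u0, 0) = 1" by (simp add: u)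
    then show ?thesis ..
  next
    case 2
    then have "form4 u (0, 0, 0, 1 / u1) = 1" by (simp add: u)
    then show ?thesis ..
  next
    case 3
    then have "form4 u (- 1 / u2, 0, 0, 0) = 1" by (simp add: u)
    then show ?thesis ..
  next
    case 4
    then have "form4 u (0, - 1 / u3, 0, 0) = 1" by (simp add: u)
    then show ?thesis ..
  qed
qed

text \<open>Translation along \<open>e\<close> preserves \<open>A\<close> and carries every level
  set of \<open>form4 u\<close> onto every other, so all of them have the same size.\<close>

lemma card_slice:
  fixes A :: "'b::{field,finite} vec4 set"
  assumes inv: "\<And>x t. x \<in> A \<Longrightarrow> shift4 t e x \<in> A" and e: "form4 u e = 1"
  shows "CARD('b) * card {x \<in> A. form4 u x = \<alpha>} = card A"
proof -
  have *: "card {x \<in> A. form4 u x = \<beta>} = card {x \<in> A. form4 u x = \<alpha>}" for \<beta>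
  proof (rule bij_betw_same_card, rule bij_betw_byWitness[where f = "shift4 (\<alpha> - \<beta>) e" and f' = "shift4 (- (\<alpha> - \<beta>)) e"])
    show "shift4 (\<alpha> - \<beta>) e ` {x \<in> A. form4 u x = \<beta>} \<subseteq> {x \<in> A. form4 u x = \<alpha>}"
      by (rule image_subsetI) (simp only: mem_Collect_eq inv form4_shift4 e, simp)
    show "shift4 (- (\<alpha> - \<beta>)) e ` {x \<in> A. form4 u x = \<alpha>} \<subseteq> {x \<in> A. form4 u x = \<beta>}"
      by (rule image_subsetI) (simp only: mem_Collect_eq inv form4_shift4 e, simp)
  qed (simp_all only: shift4_inverse shift4_inverse' ball_simps simp_thms)
  have "(\<Sum>\<beta>\<in>UNIV. card {x \<in> A. form4 u x = \<beta>}) = (\<Sum>\<beta>\<in>(UNIV :: 'b set). card {x \<in> A. form4 u x = \<alpha>})"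
    by (intro sum.cong refl *)
  then have "(\<Sum>\<beta>\<in>UNIV. card {x \<in> A. form4 u x = \<beta>}) = CARD('b) * card {x \<in> A. form4 u x = \<alpha>}"
    by simp
  moreover have "card A = (\<Sum>\<beta>\<in>UNIV. card {x \<in> A. form4 u x = \<beta>})"
    using sum.group[of A UNIV "form4 u" "\<lambda>_. 1::nat"] by simp
  ultimately show ?thesis by simp
qed

context ternary_field
begin

lemma card_vec4: "card (UNIV :: 'a vec4 set) = q ^ 4"
  by (simp add: card_prod card_field power4_eq_xxxx)

lemma q_cancel: "q * a = q * b \<Longrightarrow> a = b"
  using q_gt_1 by simp

lemma card_form4_slice1:
  assumes "(u :: 'a vec4) \<noteq> (0, 0, 0, 0)"
  shows "card {y. form4 u y = \<alpha>} = q ^ 3"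
proof -
  obtain e where "form4 u e = 1" using form4_dual[OF assms] by blast
  then have "CARD('a) * card {y \<in> UNIV. form4 u y = \<alpha>} = card (UNIV :: 'a vec4 set)"
    by (intro card_slice) auto
  then have "q * card {y. form4 u y = \<alpha>} = q ^ 4"
    by (simp only: card_vec4 card_field UNIV_I simp_thms)
  also have "q ^ 4 = q * q ^ 3" by (simp add: eval_nat_numeral)
  finally show ?thesis by (rule q_cancel)
qed

lemma card_form4_slice2:
  assumes "form4 u (y :: 'a vec4) = 1"
  shows "card {x. form4 u x = 0 \<and> form4 y x = \<alpha>} = q ^ 2"
proof -
  have u: "u \<noteq> (0, 0, 0, 0)" using assms by (cases y) auto
  \<comment> \<open>\<open>e\<close> is - u: adding its multiples preserves \<open>form4 u\<close>,
    because the form is alternating, and moves \<open>form4 y\<close>, because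
    \<open>form4 y u\<close> is - 1.\<close>
  define e where "e = shift4 (- 1) u (0, 0, 0, 0)"
  have e: "form4 x e = - form4 x u" for x :: "'a vec4"
    unfolding e_def form4_shift4 by (cases x) simp
  have "form4 y e = 1" "form4 u e = 0"
    unfolding e form4_swap[of y u] assms form4_self by simp_all
  then have "CARD('a) * card {x \<in> {x. form4 u x = 0}. form4 y x = \<alpha>} = card {x. form4 u x = 0}"
    by (intro card_slice) (simp_all only: form4_shift4 mem_Collect_eq mult_zero_right add_0_left)
  then have "q * card {x \<in> {x. form4 u x = 0}. form4 y x = \<alpha>} = q ^ 3"
    by (simp only: card_form4_slice1[OF u] card_field)
  also have "q ^ 3 = q * q ^ 2" by (simp add: eval_nat_numeral)
  finally show ?thesis using q_gt_1 by simp
qed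

lemma card_form4_slice3:
  assumes uy: "form4 u (y :: 'a vec4) = 1" and v: "form4 u v = 0" "form4 y v = 0" "v \<noteq> (0, 0, 0, 0)"
  shows "card {z. form4 u z = 0 \<and> form4 y z = 0 \<and> form4 v z = 1} = q"
proof -
  obtain w where w: "form4 v w = 1" using form4_dual[OF v(3)] by blast
  \<comment> \<open>The component of \<open>w\<close> orthogonal to the hyperbolic pair u, y. As
    \<open>v\<close> is orthogonal to this pair, \<open>form4 v e\<close> equals
    \<open>form4 v w\<close>.\<close>
  define e where "e = shift4 (form4 y w) u (shift4 (- form4 u w) y w)"
  have sw: "form4 y u = - 1" "form4 v u = 0" "form4 v y = 0"
    using uy v form4_swap[of y u] by (simp_all add: form4_eq_0_swap)
  have e: "form4 u e = 0" "form4 y e = 0" "form4 v e = 1"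
    unfolding e_def form4_shift4 form4_self uy sw w by simp_all
  have "CARD('a) * card {z \<in> {z. form4 u z = 0 \<and> form4 y z = 0}. form4 v z = 1} = card {z. form4 u z = 0 \<and> form4 y z = 0}"
    by (rule card_slice[OF _ e(3)]) (simp add: form4_shift4 e)
  then have "q * card {z \<in> {z. form4 u z = 0 \<and> form4 y z = 0}. form4 v z = 1} = q ^ 2"
    by (simp only: card_form4_slice2[OF uy] card_field)
  then show ?thesis using q_gt_1 by (simp add: power2_eq_square conj_assoc)
qed

text \<open>Taking u, y, v, z in this order completes one hyperbolic pair before the next: q^4 - 1
  vectors u, q^3 partners y, then q^2 - 1 nonzero vectors v orthogonal to both and q partners
  z.\<close>

lemma card_symplectic_bases: "card (symplectic_bases :: ('a vec4 \<times> 'a vec4 \<times> 'a vec4 \<times> 'a vec4) set) = q ^ 4 * (q ^ 2 - 1) * (q ^ 4 - 1)"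
proof -
  let ?o = "(0, 0, 0, 0) :: 'a vec4"
  let ?Y = "\<lambda>u :: 'a vec4. {y. form4 u y = 1}"
  let ?V = "\<lambda>u y :: 'a vec4. {v. form4 u v = 0 \<and> form4 y v = 0} - {?o}"
  let ?Z = "\<lambda>u y v :: 'a vec4. {z. form4 u z = 0 \<and> form4 y z = 0 \<and> form4 v z = 1}"
  let ?S = "SIGMA u : UNIV - {?o}. SIGMA y : ?Y u. SIGMA v : ?V u y. ?Z u y v"
  have zero': "form4 y ?o = 0" for y by (cases y) simp
  have zero: "form4 ?o y = 0" for y by (cases y) simp
  have "bij_betw (\<lambda>(u, v, y, z). (u, y, v, z)) symplectic_bases ?S"
  proof (rule bij_betw_byWitness[where f' = "\<lambda>(u, y, v, z). (u, v, y, z)"])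
    show "(\<lambda>(u, v, y, z). (u, y, v, z)) ` symplectic_bases \<subseteq> ?S"
      unfolding symplectic_bases_def by (auto simp: zero form4_eq_0_swap simp del: form4.simps)
    show "(\<lambda>(u, y, v, z). (u, v, y, z)) ` ?S \<subseteq> symplectic_bases"
      unfolding symplectic_bases_def by (auto simp: form4_eq_0_swap simp del: form4.simps)
  qed auto
  then have "card (symplectic_bases :: ('a vec4 \<times> 'a vec4 \<times> 'a vec4 \<times> 'a vec4) set) = card ?S"
    by (rule bij_betw_same_card)
  also have "\<dots> = (\<Sum>u\<in>UNIV - {?o}. \<Sum>y\<in>?Y u. \<Sum>v\<in>?V u y. card (?Z u y v))"
    by (simp add: card_SigmaI)
  also have "\<dots> = (\<Sum>u\<in>UNIV - {?o}. \<Sum>y\<in>?Y u. \<Sum>v\<in>?V u y. q)"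
    by (intro sum.cong refl card_form4_slice3) auto
  also have "\<dots> = (\<Sum>u\<in>UNIV - {?o}. \<Sum>y\<in>?Y u. (q ^ 2 - 1) * q)"
  proof (intro sum.cong refl)
    fix u y assume "y \<in> ?Y u"
    then have "form4 u y = 1" by simp
    from card_form4_slice2[OF this, of 0] have "card (?V u y) = q ^ 2 - 1"
      by (subst card_Diff_singleton) (auto simp: zero' simp del: form4.simps)
    then show "(\<Sum>v\<in>?V u y. q) = (q ^ 2 - 1) * q" by simp
  qed
  also have "\<dots> = (\<Sum>u\<in>UNIV - {?o}. q ^ 3 * ((q ^ 2 - 1) * q))"
    by (intro sum.cong refl) (simp add: card_form4_slice1)
  also have "\<dots> = (q ^ 4 - 1) * (q ^ 3 * ((q ^ 2 - 1) * q))"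
  proof -
    have "card (UNIV - {?o}) = q ^ 4 - 1"
      unfolding card_vec4[symmetric] by (rule card_Diff_singleton) simp
    then show ?thesis by (simp only: sum_constant of_nat_id)
  qed
  finally show ?thesis by (simp add: eval_nat_numeral mult_ac)
qed

section \<open>Gauss sums of symplectic groups\<close>

lemma sum_add_char_nonzero: "b \<noteq> 0 \<Longrightarrow> (\<Sum>x\<in>UNIV. add_char r (b * x)) = (0 :: complex)" for b :: 'a
  by (simp add: sum_add_char)

text \<open>The substitution \<alpha> = a x turns \<alpha> + a^2 / \<alpha> into a (x + 1 /
  x).\<close>

lemma kloosterman_square:
  assumes "a \<noteq> (0::'a)"
  shows "kloosterman r (a ^ 2) = (\<Sum>x\<in>UNIV - {0}. add_char r (a * (x + inverse x)))"
  unfolding kloosterman_def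
proof (rule sum.reindex_bij_witness[of _ "\<lambda>x. a * x" "\<lambda>x. x / a"])
  show "add_char r (a * (x / a + inverse (x / a))) = add_char r (x + a ^ 2 * inverse x)" for x
    using assms by (simp add: distrib_left power2_eq_square inverse_eq_divide)
qed (use assms in auto)

section \<open>Sums over 2 by 2 matrices and the Gauss sum of Sp(2, q)\<close>

lemma sum_products:
  fixes H :: "'a \<Rightarrow> complex"
  shows "(\<Sum>b\<in>UNIV. \<Sum>c\<in>UNIV. H (b * c)) = of_nat q * H 0 + of_nat (q - 1) * (\<Sum>m\<in>UNIV. H m)"
proof -
  have "(\<Sum>c\<in>UNIV. H (b * c)) = (\<Sum>m\<in>UNIV. H m)" if "b \<noteq> 0" for b
    by (rule sum.reindex_bij_witness[of _ "\<lambda>m. m / b" "\<lambda>c. b * c"]) (use that in auto)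
  then have "(\<Sum>b\<in>UNIV - {0}. \<Sum>c\<in>UNIV. H (b * c)) = (\<Sum>b\<in>UNIV - {0::'a}. \<Sum>m\<in>UNIV. H m)"
    by (intro sum.cong[OF refl, of "UNIV - {0}"]) auto
  also have "\<dots> = of_nat (q - 1) * (\<Sum>m\<in>UNIV. H m)"
    by (simp add: card_Diff_subset card_field)
  finally show ?thesis
    using sum.remove[of UNIV "0::'a" "\<lambda>b. \<Sum>c\<in>UNIV. H (b * c)"] by (simp add: card_field)
qed

text \<open>The off-diagonal entries matter only through m = b c; every m arises q - 1 times, and m
  = 0 another q times. This gives a part uniform in the determinant and a part with b c = 0. Here
  \<open>G\<close> takes trace and determinant: supported at determinant 1 it yields SL(2), at
  nonzero determinants GL(2).\<close>

lemma sum_matrices2: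
  fixes G :: "'a \<Rightarrow> 'a \<Rightarrow> complex"
  shows "(\<Sum>(x, b, c, y)\<in>UNIV. G (x + y) (x * y - b * c)) =
    of_nat (q - 1) * (\<Sum>x\<in>UNIV. \<Sum>y\<in>UNIV. \<Sum>d\<in>UNIV. G (x + y) d) +
    of_nat q * (\<Sum>x\<in>UNIV. \<Sum>y\<in>UNIV. G (x + y) (x * y))"
proof -
  have shift: "(\<Sum>m\<in>UNIV. G t (p - m)) = (\<Sum>d\<in>UNIV. G t d)" for t p
    by (rule sum.reindex_bij_witness[of _ "\<lambda>d. p - d" "\<lambda>m. p - m"]) auto
  have "(\<Sum>(x, b, c, y)\<in>UNIV. G (x + y) (x * y - b * c)) =
      (\<Sum>(x, y, b, c)\<in>UNIV. G (x + y) (x * y - b * c))"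
    by (rule sum.reindex_bij_witness[of _ "\<lambda>(x, y, b, c). (x, b, c, y)" "\<lambda>(x, b, c, y). (x, y, b, c)"]) auto
  also have "\<dots> = (\<Sum>x\<in>UNIV. \<Sum>y\<in>UNIV. \<Sum>b\<in>UNIV. \<Sum>c\<in>UNIV. G (x + y) (x * y - b * c))"
    unfolding UNIV_Times_UNIV[symmetric] by (simp add: sum.cartesian_product split_def)
  also have "\<dots> = (\<Sum>x\<in>UNIV. \<Sum>y\<in>UNIV. of_nat q * G (x + y) (x * y) + of_nat (q - 1) * (\<Sum>d\<in>UNIV. G (x + y) d))"
    by (intro sum.cong refl) (simp add: sum_products[of "\<lambda>m. G _ (_ - m)"] shift)
  finally show ?thesis
    by (simp only: sum.distrib sum_distrib_left add.commute)
qed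

lemma sum_Sp_1_trace:
  fixes F :: "'a \<Rightarrow> complex"
  shows "(\<Sum>g\<in>Sp 1. F (mat_trace g)) = of_nat (q - 1) * (\<Sum>x\<in>UNIV. \<Sum>y\<in>UNIV. F (x + y)) +
    of_nat q * (\<Sum>x\<in>UNIV - {0}. F (x + inverse x))"
proof -
  let ?G = "\<lambda>t (d::'a). if d = 1 then F t else 0"
  have inner: "(\<Sum>y\<in>UNIV. ?G (x + y) (x * y)) = (if x \<noteq> 0 then F (x + inverse x) else 0)" for x
  proof (cases "x = 0")
    case False
    then have "x * y = 1 \<longleftrightarrow> y = inverse x" for y by (metis inverse_unique right_inverse)
    then show ?thesis using False by simp
  qed simp
  have "(\<Sum>g\<in>Sp 1. F (mat_trace g)) = (\<Sum>(x, b, c, y)\<in>UNIV. ?G (x + y) (x * y - b * c))"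
    unfolding sum_Sp_1 by (rule sum.mono_neutral_cong_left) (auto split: if_splits)
  also have "\<dots> = of_nat (q - 1) * (\<Sum>x\<in>UNIV. \<Sum>y\<in>UNIV. \<Sum>d\<in>UNIV. ?G (x + y) d) +
      of_nat q * (\<Sum>x\<in>UNIV. \<Sum>y\<in>UNIV. ?G (x + y) (x * y))"
    by (rule sum_matrices2[of ?G])
  also have "\<dots> = of_nat (q - 1) * (\<Sum>x\<in>UNIV. \<Sum>y\<in>UNIV. F (x + y)) +
      of_nat q * (\<Sum>x\<in>UNIV. if x \<noteq> 0 then F (x + inverse x) else 0)"
    unfolding inner by simp
  also have "(\<Sum>x\<in>UNIV. if x \<noteq> 0 then F (x + inverse x) else 0) = (\<Sum>x\<in>UNIV - {0}. F (x + inverse x))"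
    by (rule sum.mono_neutral_cong_right) auto
  finally show ?thesis .
qed

text \<open>The uniform part vanishes by orthogonality, and the rest is the symmetric form of the
  Kloosterman sum.\<close>

lemma gauss_sum_Sp_1:
  assumes "a \<noteq> (0::'a)"
  shows "(\<Sum>g\<in>Sp 1. add_char r (a * mat_trace g)) = of_nat q * kloosterman r (a ^ 2)"
proof -
  have "(\<Sum>x\<in>UNIV. \<Sum>y\<in>UNIV. add_char r (a * (x + y))) = 0"
    by (simp add: distrib_left add_char_add sum_distrib_left[symmetric] sum_add_char_nonzero[OF assms])
  then show ?thesis
    using sum_Sp_1_trace[of "\<lambda>t. add_char r (a * t)"] kloosterman_square[OF assms] by simp
qed

lemma card_Sp_1: "card (Sp 1 :: 'a mat set) = q * (q ^ 2 - 1)"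
proof -
  have "of_nat (card (Sp 1 :: 'a mat set)) = (\<Sum>g\<in>(Sp 1 :: 'a mat set). 1 :: complex)" by simp
  also have "\<dots> = of_nat ((q - 1) * (q * q) + q * (q - 1))"
    using sum_Sp_1_trace[of "\<lambda>_. 1"] by (simp add: card_field card_Diff_subset)
  also have "(q - 1) * (q * q) + q * (q - 1) = q * (q ^ 2 - 1)"
    using q_gt_1 by (simp add: algebra_simps power2_eq_square)
  finally show ?thesis by (simp only: of_nat_eq_iff)
qed

text \<open>For trace t and determinant d, tr A + tr A^-1 is t + t / d. In the uniform part of
  \<open>sum_matrices2\<close> this is t (1 + 1 / d), which survives orthogonality only at d = - 1.
  In the part with d = x y it separates into x + 1 / x and y + 1 / y, giving the square of the
  Kloosterman sum.\<close>

lemma sum_GL_2: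
  assumes a: "a \<noteq> (0::'a)"
  shows "(\<Sum>(x, b, c, y) | x * y - b * c \<noteq> 0. add_char r (a * ((x + y) + (x + y) / (x * y - b * c)))) =
    of_nat q * kloosterman r (a ^ 2) ^ 2 + of_nat (q - 1) * of_nat q ^ 2"
proof -
  let ?G = "\<lambda>t d. if d \<noteq> 0 then add_char r (a * (t + t / d)) else 0"
  let ?k = "\<lambda>x. add_char r (a * (x + inverse x))"
  have "(\<Sum>x\<in>UNIV. \<Sum>y\<in>UNIV. ?G (x + y) d) = (if d = - 1 then of_nat q ^ 2 else 0)" for d
  proof (cases "d = 0")
    case False
    have "(\<Sum>x\<in>UNIV. \<Sum>y\<in>UNIV. ?G (x + y) d) =
        (\<Sum>x\<in>UNIV. \<Sum>y\<in>UNIV. add_char r ((a * (1 + 1 / d)) * x) * add_char r ((a * (1 + 1 / d)) * y))"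
      unfolding add_char_add[symmetric] using False
      by (intro sum.cong refl) (simp add: algebra_simps add_divide_distrib)
    also have "\<dots> = (\<Sum>x\<in>UNIV. add_char r ((a * (1 + 1 / d)) * x)) ^ 2"
      by (simp add: sum_distrib_left[symmetric] sum_distrib_right[symmetric] power2_eq_square)
    also have "a * (1 + 1 / d) = 0 \<longleftrightarrow> d = - 1"
    proof -
      have "1 + 1 / d = (d + 1) / d" using False by (simp add: add_divide_distrib)
      then show ?thesis using a False by (simp add: eq_neg_iff_add_eq_0)
    qed
    then have "(\<Sum>x\<in>UNIV. add_char r ((a * (1 + 1 / d)) * x)) ^ 2 = (if d = - 1 then of_nat q ^ 2 else 0)"
      by (simp add: sum_add_char del: mult_eq_0_iff)
    finally show ?thesis .
  qed (use signs_distinct in auto)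
  then have "(\<Sum>d\<in>UNIV. \<Sum>x\<in>UNIV. \<Sum>y\<in>UNIV. ?G (x + y) d) = of_nat q ^ 2" by simp
  moreover have "(\<Sum>x\<in>UNIV. \<Sum>y\<in>UNIV. \<Sum>d\<in>UNIV. ?G (x + y) d) = (\<Sum>x\<in>UNIV. \<Sum>d\<in>UNIV. \<Sum>y\<in>UNIV. ?G (x + y) d)"
    by (intro sum.cong refl sum.swap)
  moreover have "\<dots> = (\<Sum>d\<in>UNIV. \<Sum>x\<in>UNIV. \<Sum>y\<in>UNIV. ?G (x + y) d)" by (rule sum.swap)
  ultimately have first: "(\<Sum>x\<in>UNIV. \<Sum>y\<in>UNIV. \<Sum>d\<in>UNIV. ?G (x + y) d) = of_nat q ^ 2" by simp
  have "(\<Sum>x\<in>UNIV. \<Sum>y\<in>UNIV. ?G (x + y) (x * y)) = (\<Sum>x\<in>UNIV - {0}. \<Sum>y\<in>UNIV. ?G (x + y) (x * y))"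
    by (rule sum.mono_neutral_right) auto
  also have "\<dots> = (\<Sum>x\<in>UNIV - {0}. \<Sum>y\<in>UNIV - {0}. ?k x * ?k y)"
  proof (rule sum.cong[OF refl])
    fix x :: 'a assume x: "x \<in> UNIV - {0}"
    show "(\<Sum>y\<in>UNIV. ?G (x + y) (x * y)) = (\<Sum>y\<in>UNIV - {0}. ?k x * ?k y)"
    proof (rule sum.mono_neutral_cong_right)
      show "?G (x + y) (x * y) = ?k x * ?k y" if "y \<in> UNIV - {0}" for y
      proof -
        have "(x + y) / (x * y) = inverse x + inverse y" using x that by (simp add: field_simps)
        then show ?thesis using x that unfolding add_char_add[symmetric] by (simp add: algebra_simps)
      qed
    qed auto
  qed
  also have "\<dots> = kloosterman r (a ^ 2) ^ 2"
    unfolding kloosterman_square[OF a] power2_eq_square[of "sum _ _"]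
    by (simp only: sum_distrib_left[symmetric] sum_distrib_right[symmetric])
  finally have second: "(\<Sum>x\<in>UNIV. \<Sum>y\<in>UNIV. ?G (x + y) (x * y)) = kloosterman r (a ^ 2) ^ 2" .
  have "(\<Sum>(x, b, c, y) | x * y - b * c \<noteq> 0. add_char r (a * ((x + y) + (x + y) / (x * y - b * c)))) =
      (\<Sum>(x, b, c, y)\<in>UNIV. ?G (x + y) (x * y - b * c))"
    by (rule sum.mono_neutral_cong_left) (auto split: if_splits)
  also have "\<dots> = of_nat (q - 1) * (\<Sum>x\<in>UNIV. \<Sum>y\<in>UNIV. \<Sum>d\<in>UNIV. ?G (x + y) d) +
      of_nat q * (\<Sum>x\<in>UNIV. \<Sum>y\<in>UNIV. ?G (x + y) (x * y))"
    by (rule sum_matrices2[of ?G])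
  also have "\<dots> = of_nat (q - 1) * of_nat q ^ 2 + of_nat q * kloosterman r (a ^ 2) ^ 2"
    unfolding first second ..
  finally show ?thesis by (simp only: add.commute)
qed

end

text \<open>Left multiplication of a column by the block matrix with identity diagonal blocks, lower
  left block 0 and symmetric upper right block with rows (s1, s2) and (s2, s3).\<close>

fun unipotent4 :: "'b::field \<times> 'b \<times> 'b \<Rightarrow> 'b vec4 \<Rightarrow> 'b vec4" where
  "unipotent4 (s1, s2, s3) (x0, x1, x2, x3) = (x0 + s1 * x2 + s2 * x3, x1 + s2 * x2 + s3 * x3, x2, x3)"

lemma form4_unipotent4: "form4 (unipotent4 s x) (unipotent4 s y) = form4 x y"
  by (cases s; cases x; cases y) (simp add: algebra_simps)

lemma unipotent4_inverse:
  "unipotent4 (- s1, - s2, - s3) (unipotent4 (s1, s2, s3) x) = x"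
  "unipotent4 (s1, s2, s3) (unipotent4 (- s1, - s2, - s3) x) = x"
  by (cases x; simp)+

text \<open>Lists the block column by column, so an antisymmetric one reads (0, - c, c, 0).\<close>

fun lower_left4 :: "'b vec4 \<times> 'b vec4 \<times> 'b vec4 \<times> 'b vec4 \<Rightarrow> 'b vec4" where
  "lower_left4 ((_, _, u2, u3), (_, _, v2, v3), _, _) = (u2, u3, v2, v3)"

lemma trace4_unipotent4:
  assumes "lower_left4 (u, v, y, z) = (c1, c3, c2, c4)"
  shows "trace4 (unipotent4 (s1, s2, s3) u, unipotent4 (s1, s2, s3) v,
      unipotent4 (s1, s2, s3) y, unipotent4 (s1, s2, s3) z) =
    trace4 (u, v, y, z) + (c1 * s1 + (c2 + c3) * s2 + c4 * s3)"
  using assms by (cases u; cases v; cases y; cases z) (simp add: algebra_simps)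

section \<open>Splitting the Gauss sum of Sp(4, q) by the lower left block\<close>

context ternary_field
begin

definition antisymmetric_bases :: "('a vec4 \<times> 'a vec4 \<times> 'a vec4 \<times> 'a vec4) set" where
  "antisymmetric_bases = {t \<in> symplectic_bases. \<exists>c. lower_left4 t = (0, - c, c, 0)}"

text \<open>Averaging over left multiplication by the unipotent matrices with symmetric upper right
  block \<open>S\<close>, which changes the trace by \<open>tr (S C)\<close>, kills every lower left block \<open>C\<close> that
  is not antisymmetric.\<close>

lemma gauss_sum_antisymmetric:
  assumes a: "a \<noteq> (0::'a)"
  shows "(\<Sum>t\<in>symplectic_bases. add_char r (a * trace4 t)) = (\<Sum>t\<in>antisymmetric_bases. add_char r (a * trace4 t))"
proof -
  let ?B = "symplectic_bases :: ('a vec4 \<times> 'a vec4 \<times> 'a vec4 \<times> 'a vec4) set"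
  define n where "n s = (\<lambda>(u, v, y, z). (unipotent4 s u, unipotent4 s v, unipotent4 s y, unipotent4 s z))"
    for s :: "'a \<times> 'a \<times> 'a"
  define S where "S = (\<Sum>t\<in>?B. add_char r (a * trace4 t))"
  have nB: "n s t \<in> ?B" if "t \<in> ?B" for s t
    using that by (cases t) (simp add: n_def symplectic_bases_def form4_unipotent4)
  have S: "(\<Sum>t\<in>?B. add_char r (a * trace4 (n (s1, s2, s3) t))) = S" for s1 s2 s3
    unfolding S_def
    by (rule sum.reindex_bij_witness[of _ "n (- s1, - s2, - s3)" "n (s1, s2, s3)"])
      (auto simp only: nB, auto simp: n_def unipotent4_inverse)
  define e where "e t s1 s2 s3 = (case lower_left4 t of (c1, c3, c2, c4) \<Rightarrow>
      add_char r (a * c1 * s1) * add_char r (a * (c2 + c3) * s2) * add_char r (a * c4 * s3))"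
    for t :: "'a vec4 \<times> 'a vec4 \<times> 'a vec4 \<times> 'a vec4" and s1 s2 s3
  have tr: "add_char r (a * trace4 (n (s1, s2, s3) t)) = add_char r (a * trace4 t) * e t s1 s2 s3" for t s1 s2 s3
  proof -
    obtain u v y z where t: "t = (u, v, y, z)" by (cases t)
    obtain c1 c3 c2 c4 where l: "lower_left4 (u, v, y, z) = (c1, c3, c2, c4)" using prod_cases4 by blast
    have "a * (b + (c1 * s1 + (c2 + c3) * s2 + c4 * s3)) =
        a * b + (a * c1 * s1 + a * (c2 + c3) * s2 + a * c4 * s3)" for b
      by (simp add: algebra_simps)
    then show ?thesis
      unfolding t n_def e_def by (simp only: l trace4_unipotent4[OF l] add_char_add prod.case)
  qed
  \<comment> \<open>The three parameters of S enter through separate factors, so three orthogonality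
    relations force c1 = 0, c2 + c3 = 0 and c4 = 0.\<close>
  have avg: "(\<Sum>s1\<in>UNIV. \<Sum>s2\<in>UNIV. \<Sum>s3\<in>UNIV. e t s1 s2 s3) =
      (if \<exists>c. lower_left4 t = (0, - c, c, 0) then of_nat q ^ 3 else 0)" for t
  proof -
    obtain c1 c3 c2 c4 where l: "lower_left4 t = (c1, c3, c2, c4)" using prod_cases4 by blast
    have "(\<Sum>s1\<in>UNIV. \<Sum>s2\<in>UNIV. \<Sum>s3\<in>UNIV. e t s1 s2 s3) =
       (\<Sum>s1\<in>UNIV. add_char r (a * c1 * s1)) * (\<Sum>s2\<in>UNIV. add_char r (a * (c2 + c3) * s2)) *
       (\<Sum>s3\<in>UNIV. add_char r (a * c4 * s3))"
      by (simp add: e_def l sum_distrib_left[symmetric] sum_distrib_right[symmetric])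
    also have "\<dots> = (if c1 = 0 \<and> c2 + c3 = 0 \<and> c4 = 0 then of_nat q ^ 3 else 0)"
      using a by (simp only: sum_add_char mult_eq_0_iff) (simp add: power3_eq_cube)
    also have "c1 = 0 \<and> c2 + c3 = 0 \<and> c4 = 0 \<longleftrightarrow> (\<exists>c. lower_left4 t = (0, - c, c, 0))"
      by (auto simp: l add_eq_0_iff)
    finally show ?thesis .
  qed
  have "of_nat q ^ 3 * S = (\<Sum>s1\<in>(UNIV::'a set). \<Sum>s2\<in>(UNIV::'a set). \<Sum>s3\<in>(UNIV::'a set). S)"
    by (simp add: card_field power3_eq_cube)
  also have "\<dots> = (\<Sum>s1\<in>UNIV. \<Sum>s2\<in>UNIV. \<Sum>s3\<in>UNIV. \<Sum>t\<in>?B. add_char r (a * trace4 t) * e t s1 s2 s3)"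
    by (intro sum.cong refl, rule trans[OF S[symmetric]]) (simp only: tr)
  also have "\<dots> = (\<Sum>t\<in>?B. add_char r (a * trace4 t) * (\<Sum>s1\<in>UNIV. \<Sum>s2\<in>UNIV. \<Sum>s3\<in>UNIV. e t s1 s2 s3))"
    by (simp only: sum.swap[of _ _ ?B] sum_distrib_left)
  also have "\<dots> = (\<Sum>t\<in>?B. if \<exists>c. lower_left4 t = (0, - c, c, 0) then of_nat q ^ 3 * add_char r (a * trace4 t) else 0)"
    by (intro sum.cong refl) (simp add: avg)
  also have "\<dots> = of_nat q ^ 3 * (\<Sum>t\<in>antisymmetric_bases. add_char r (a * trace4 t))"
    unfolding antisymmetric_bases_def sum_distrib_left by (rule sum.inter_filter[symmetric]) simp
  finally show ?thesis using q_gt_1 by (simp add: S_def)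
qed

text \<open>Let A and D be the diagonal blocks. The relation between the first two columns says tr A
  = 0, and the one between the last two then says tr D = 0. Otherwise A, D and the nonzero c are
  free, which makes (q - 1) q^6 choices, and they determine the upper right block. All these traces
  are 0.\<close>

lemma sum_antisymmetric_nonzero:
  "(\<Sum>t\<in>{t \<in> antisymmetric_bases. lower_left4 t \<noteq> (0, 0, 0, 0)}. F (trace4 t)) = of_nat ((q - 1) * q ^ 6) * F 0"
  for F :: "'a \<Rightarrow> complex"
proof -
  let ?P = "(UNIV - {0 :: 'a}) \<times> (UNIV :: ('a \<times> 'a \<times> 'a \<times> 'a \<times> 'a \<times> 'a) set)"
  \<comment> \<open>The quotients by \<open>c\<close> solve the four relations between a left and a
    right column: each contains exactly one entry of the upper right block, with coefficient c or -
    c.\<close>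
  let ?i = "\<lambda>(c :: 'a, a1, a2, a3, d1, d2, d3).
    ((a1, a3, 0, - c), (a2, - a1, c, 0),
     ((a2 * d1 - a1 * d3) / c, (1 - a1 * d1 - a3 * d3) / c, d1, d3),
     ((a2 * d2 + a1 * d1 - 1) / c, (a3 * d1 - a1 * d2) / c, d2, - d1))"
  let ?j = "\<lambda>((a1, a3, _ :: 'a, _ :: 'a), (a2, a4 :: 'a, c, _ :: 'a), (b1 :: 'a, b3 :: 'a, d1, d3), (b2 :: 'a, b4 :: 'a, d2, d4 :: 'a)).
    (c :: 'a, a1 :: 'a, a2 :: 'a, a3 :: 'a, d1 :: 'a, d2 :: 'a, d3 :: 'a)"
  have i: "?i p \<in> {t \<in> antisymmetric_bases. lower_left4 t \<noteq> (0, 0, 0, 0)}" "trace4 (?i p) = 0"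
    if p: "p \<in> ?P" for p
  proof -
    obtain c a1 a2 a3 d1 d2 d3 where pp: "p = (c, a1, a2, a3, d1, d2, d3)" by (cases p)
    have c: "c \<noteq> 0" using p pp by simp
    show "?i p \<in> {t \<in> antisymmetric_bases. lower_left4 t \<noteq> (0, 0, 0, 0)}"
      using c by (simp add: pp antisymmetric_bases_def symplectic_bases_def) (simp add: field_simps)
    show "trace4 (?i p) = 0" by (simp add: pp)
  qed
  have j: "?i (?j t) = t" "?j t \<in> ?P"
    if t: "t \<in> {t \<in> antisymmetric_bases. lower_left4 t \<noteq> (0, 0, 0, 0)}" for t
  proof -
    obtain a1 a3 c1 c3 a2 a4 c2 c4 b1 b3 d1 d3 b2 b4 d2 d4 where
      tt: "t = ((a1, a3, c1, c3), (a2, a4, c2, c4), (b1, b3, d1, d3), (b2, b4, d2, d4))"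
      by (cases t) auto
    define c where "c = c2"
    have k: "c1 = 0" "c3 = - c" "c4 = 0" "c2 = c" and c: "c \<noteq> 0"
      using t by (auto simp: tt antisymmetric_bases_def c_def)
    have e: "a1 * d1 + (a3 * d3 + c * b3) = 1" "a2 * d2 - c * b2 + a4 * d4 = 1"
      "a1 * c + c * a4 = 0" "a1 * d2 + (a3 * d4 + c * b4) = 0" "a2 * d1 - c * b1 + a4 * d3 = 0"
      "b1 * d2 - d1 * b2 + (b3 * d4 - d3 * b4) = 0"
      using t by (simp_all add: tt antisymmetric_bases_def symplectic_bases_def k)
    have "c * (a1 + a4) = 0" using e(3) by Groebner_Basis.algebra
    then have a4: "a4 = - a1" using c by (simp add: eq_neg_iff_add_eq_0 add.commute)
    \<comment> \<open>Multiplication by \<open>c\<close> allows the upper right block to be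
      eliminated from the relation between the last two columns; what remains is the trace of the
      lower right block.\<close>
    have "c * (b1 * d2 - d1 * b2 + (b3 * d4 - d3 * b4)) = d1 + d4"
      using e a4 by Groebner_Basis.algebra
    then have d4: "d4 = - d1" using e(6) by (simp add: eq_neg_iff_add_eq_0 add.commute)
    have "c * b1 = a2 * d1 - a1 * d3" "c * b3 = 1 - a1 * d1 - a3 * d3"
      "c * b2 = a2 * d2 + a1 * d1 - 1" "c * b4 = a3 * d1 - a1 * d2"
      using e a4 d4 by Groebner_Basis.algebra+
    then have b: "b1 = (a2 * d1 - a1 * d3) / c" "b3 = (1 - a1 * d1 - a3 * d3) / c"
      "b2 = (a2 * d2 + a1 * d1 - 1) / c" "b4 = (a3 * d1 - a1 * d2) / c"
      using c by (simp_all add: eq_divide_eq mult.commute)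
    show "?i (?j t) = t" "?j t \<in> ?P"
      using c by (simp_all add: tt k a4 d4 b)
  qed
  have "(\<Sum>t\<in>{t \<in> antisymmetric_bases. lower_left4 t \<noteq> (0, 0, 0, 0)}. F (trace4 t)) = (\<Sum>p\<in>?P. F 0)"
  proof (rule sum.reindex_bij_witness[of _ ?i ?j])
    show "?j (?i p) = p" if "p \<in> ?P" for p by (cases p) simp
    show "F 0 = F (trace4 t)" if "t \<in> {t \<in> antisymmetric_bases. lower_left4 t \<noteq> (0, 0, 0, 0)}" for t
      using i(2)[OF j(2)[OF that]] j(1)[OF that] by simp
  qed (fact j i)+
  also have "\<dots> = of_nat ((q - 1) * q ^ 6) * F 0"
    by (simp add: card_cartesian_product card_Diff_subset card_prod card_field eval_nat_numeral)
  finally show ?thesis .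
qed

text \<open>With C = 0 the diagonal blocks are A and its inverse transpose, and the upper right
  block is A S with S symmetric. So S accounts for the factor q^3, and the trace is tr A + tr A^-1 =
  tr A + tr A / det A.\<close>

lemma sum_antisymmetric_zero:
  "(\<Sum>t\<in>{t \<in> antisymmetric_bases. lower_left4 t = (0, 0, 0, 0)}. F (trace4 t)) =
    of_nat (q ^ 3) * (\<Sum>(x, b, c, y) | x * y - b * c \<noteq> 0. F ((x + y) + (x + y) / (x * y - b * c)))"
  for F :: "'a \<Rightarrow> complex"
proof -
  let ?GL = "{(x, b, c, y). x * y - b * c \<noteq> (0::'a)}"
  let ?P = "?GL \<times> (UNIV :: ('a \<times> 'a \<times> 'a) set)"
  let ?F = "\<lambda>(x, b, c, y). F ((x + y) + (x + y) / (x * y - b * c))"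
  let ?i = "\<lambda>((a1 :: 'a, a2, a3, a4), (s1, s2, s3)).
    ((a1, a3, 0, 0), (a2, a4, 0, 0),
     (a1 * s1 + a2 * s2, a3 * s1 + a4 * s2, a4 / (a1 * a4 - a2 * a3), - a2 / (a1 * a4 - a2 * a3)),
     (a1 * s2 + a2 * s3, a3 * s2 + a4 * s3, - a3 / (a1 * a4 - a2 * a3), a1 / (a1 * a4 - a2 * a3)))"
  \<comment> \<open>S is recovered as the transpose of the lower right block times the upper right
    block; three entries suffice by symmetry.\<close>
  let ?j = "\<lambda>((a1, a3, _ :: 'a, _ :: 'a), (a2, a4, _ :: 'a, _ :: 'a), (b1 :: 'a, b3, d1, d3), (b2, b4, d2, d4)).
    ((a1 :: 'a, a2 :: 'a, a3 :: 'a, a4 :: 'a), (d1 * b1 + d3 * b3, d1 * b2 + d3 * b4, d2 * b2 + d4 * b4))"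
  have i: "?i p \<in> {t \<in> antisymmetric_bases. lower_left4 t = (0, 0, 0, 0)}" "?j (?i p) = p"
    "?F (fst p) = F (trace4 (?i p))"
    if p: "p \<in> ?P" for p
  proof -
    obtain a1 a2 a3 a4 s1 s2 s3 where pp: "p = ((a1, a2, a3, a4), (s1, s2, s3))" by (cases p) auto
    define D where "D = a1 * a4 - a2 * a3"
    have D: "D \<noteq> 0" using p pp D_def by simp
    have o: "a1 * (a4 / D) + a3 * (- a2 / D) = 1" "a2 * (- a3 / D) + a4 * (a1 / D) = 1"
      "a1 * (- a3 / D) + a3 * (a1 / D) = 0" "a2 * (a4 / D) + a4 * (- a2 / D) = 0"
    proof -
      have "a1 * (a4 / D) + a3 * (- a2 / D) = (a1 * a4 - a2 * a3) / D"
        "a2 * (- a3 / D) + a4 * (a1 / D) = (a1 * a4 - a2 * a3) / D"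
        by (simp_all add: diff_divide_distrib mult.commute)
      then show "a1 * (a4 / D) + a3 * (- a2 / D) = 1" "a2 * (- a3 / D) + a4 * (a1 / D) = 1"
        using D by (simp_all only: D_def[symmetric] divide_self[OF D])
    qed (simp_all add: mult.commute)
    define d1 d2 d3 d4 where d: "d1 = a4 / D" "d2 = - a3 / D" "d3 = - a2 / D" "d4 = a1 / D"
    have o': "a1 * d1 + a3 * d3 = 1" "a2 * d2 + a4 * d4 = 1" "a1 * d2 + a3 * d4 = 0" "a2 * d1 + a4 * d3 = 0"
      using o by (simp_all only: d)
    have ip: "?i p = ((a1, a3, 0, 0), (a2, a4, 0, 0),
       (a1 * s1 + a2 * s2, a3 * s1 + a4 * s2, d1, d3), (a1 * s2 + a2 * s3, a3 * s2 + a4 * s3, d2, d4))"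
      by (simp add: pp d D_def)
    have "(a1 * s1 + a2 * s2) * d2 - d1 * (a1 * s2 + a2 * s3) + ((a3 * s1 + a4 * s2) * d4 - d3 * (a3 * s2 + a4 * s3)) = 0"
      using o' by Groebner_Basis.algebra
    then show "?i p \<in> {t \<in> antisymmetric_bases. lower_left4 t = (0, 0, 0, 0)}"
      unfolding ip using o' by (simp add: antisymmetric_bases_def symplectic_bases_def)
    have "d1 * (a1 * s1 + a2 * s2) + d3 * (a3 * s1 + a4 * s2) = s1"
      "d1 * (a1 * s2 + a2 * s3) + d3 * (a3 * s2 + a4 * s3) = s2"
      "d2 * (a1 * s2 + a2 * s3) + d4 * (a3 * s2 + a4 * s3) = s3"
      using o' by Groebner_Basis.algebra+
    then show "?j (?i p) = p" unfolding ip by (simp add: pp)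
    show "?F (fst p) = F (trace4 (?i p))"
      unfolding ip by (simp add: pp d D_def add_divide_distrib add_ac)
  qed
  have j: "?i (?j t) = t" "?j t \<in> ?P"
    if t: "t \<in> {t \<in> antisymmetric_bases. lower_left4 t = (0, 0, 0, 0)}" for t
  proof -
    obtain a1 a3 c1 c3 a2 a4 c2 c4 b1 b3 d1 d3 b2 b4 d2 d4 where
      tt: "t = ((a1, a3, c1, c3), (a2, a4, c2, c4), (b1, b3, d1, d3), (b2, b4, d2, d4))"
      by (cases t) auto
    have k: "c1 = 0" "c3 = 0" "c4 = 0" "c2 = 0"
      using t by (auto simp: tt)
    have e: "a1 * d1 + a3 * d3 = 1" "a2 * d2 + a4 * d4 = 1" "a1 * d2 + a3 * d4 = 0" "a2 * d1 + a4 * d3 = 0"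
      "b1 * d2 - d1 * b2 + (b3 * d4 - d3 * b4) = 0"
      using t by (simp_all add: tt antisymmetric_bases_def symplectic_bases_def k)
    define D where "D = a1 * a4 - a2 * a3"
    have "D * (d1 * d4 - d2 * d3) = 1" unfolding D_def using e by Groebner_Basis.algebra
    then have D: "D \<noteq> 0" by auto
    have Dd: "D * d1 = a4" "D * d2 = - a3" "D * d3 = - a2" "D * d4 = a1"
      unfolding D_def using e by Groebner_Basis.algebra+
    then have d: "a4 / D = d1" "- a3 / D = d2" "- a2 / D = d3" "a1 / D = d4"
      unfolding Dd[symmetric] using D by simp_all
    \<comment> \<open>By \<open>e\<close> the transpose of A is a left inverse of the lower right
      block; \<open>f\<close> is the transposed statement with the factors in the other
      order.\<close>
    have f: "a1 * d1 + a2 * d2 = 1" "a3 * d3 + a4 * d4 = 1" "a1 * d3 + a2 * d4 = 0" "a3 * d1 + a4 * d2 = 0"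
    proof -
      have "D * (a1 * d1 + a2 * d2) = D * 1" "D * (a3 * d3 + a4 * d4) = D * 1"
        "D * (a1 * d3 + a2 * d4) = D * 0" "D * (a3 * d1 + a4 * d2) = D * 0"
        using Dd by (simp_all add: distrib_left mult.left_commute[of D]) (simp_all add: D_def algebra_simps)
      then show "a1 * d1 + a2 * d2 = 1" "a3 * d3 + a4 * d4 = 1" "a1 * d3 + a2 * d4 = 0" "a3 * d1 + a4 * d2 = 0"
        using D mult_left_cancel by blast+
    qed
    \<comment> \<open>The relation between the last two columns is the symmetry of the recovered
      S.\<close>
    have s: "d1 * b2 + d3 * b4 = d2 * b1 + d4 * b3" using e(5) by Groebner_Basis.algebra
    have b: "a1 * (d1 * b1 + d3 * b3) + a2 * (d1 * b2 + d3 * b4) = b1"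
      "a3 * (d1 * b1 + d3 * b3) + a4 * (d1 * b2 + d3 * b4) = b3"
      "a1 * (d1 * b2 + d3 * b4) + a2 * (d2 * b2 + d4 * b4) = b2"
      "a3 * (d1 * b2 + d3 * b4) + a4 * (d2 * b2 + d4 * b4) = b4"
      using f s by Groebner_Basis.algebra+
    have d': "- (a3 / D) = d2" "- (a2 / D) = d3" using d(2,3) by simp_all
    show "?i (?j t) = t" by (simp add: tt k b d d' D_def[symmetric])
    show "?j t \<in> ?P" using D by (simp add: tt D_def)
  qed
  have "(\<Sum>t\<in>{t \<in> antisymmetric_bases. lower_left4 t = (0, 0, 0, 0)}. F (trace4 t)) = (\<Sum>p\<in>?P. ?F (fst p))"
  proof (rule sum.reindex_bij_witness[of _ ?i ?j])
    show "?F (fst (?j t)) = F (trace4 t)" if "t \<in> {t \<in> antisymmetric_bases. lower_left4 t = (0, 0, 0, 0)}" for t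
      using i(3)[OF j(2)[OF that]] j(1)[OF that] by simp
  qed (fact j i)+
  also have "\<dots> = (\<Sum>g\<in>?GL. \<Sum>s\<in>(UNIV :: ('a \<times> 'a \<times> 'a) set). ?F g)"
    by (subst sum.cartesian_product) (simp add: split_def)
  also have "\<dots> = of_nat (q ^ 3) * (\<Sum>g\<in>?GL. ?F g)"
    by (simp add: card_prod card_field sum_distrib_left power3_eq_cube mult.assoc)
  finally show ?thesis .
qed

text \<open>The constants q^5 (q - 1) from C = 0 and q^6 (q - 1) from nonzero C add up to q^4 (q^3 -
  q).\<close>

lemma gauss_sum_Sp_2:
  assumes a: "a \<noteq> (0::'a)"
  shows "(\<Sum>g\<in>Sp 2. add_char r (a * mat_trace g)) =
    of_nat q ^ 4 * (kloosterman r (a ^ 2) ^ 2 + of_nat q ^ 3 - of_nat q)"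
proof -
  let ?f = "\<lambda>t. add_char r (a * trace4 t)"
  have "(\<Sum>g\<in>Sp 2. add_char r (a * mat_trace g)) = (\<Sum>t\<in>antisymmetric_bases. ?f t)"
    using sum_Sp_2[of "\<lambda>x. add_char r (a * x)"] gauss_sum_antisymmetric[OF a] by simp
  also have "\<dots> = (\<Sum>t\<in>{t \<in> antisymmetric_bases. lower_left4 t = (0, 0, 0, 0)}. ?f t) +
      (\<Sum>t\<in>{t \<in> antisymmetric_bases. lower_left4 t \<noteq> (0, 0, 0, 0)}. ?f t)"
    by (subst sum.union_disjoint[symmetric]) (auto intro!: sum.cong)
  also have "\<dots> = of_nat (q ^ 3) * (of_nat q * kloosterman r (a ^ 2) ^ 2 + of_nat (q - 1) * of_nat q ^ 2) +
      of_nat ((q - 1) * q ^ 6)"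
    using sum_antisymmetric_zero[of "\<lambda>x. add_char r (a * x)"]
      sum_antisymmetric_nonzero[of "\<lambda>x. add_char r (a * x)"] sum_GL_2[OF a] by simp
  also have "\<dots> = of_nat q ^ 4 * (kloosterman r (a ^ 2) ^ 2 + of_nat q ^ 3 - of_nat q)"
    using q_gt_1 by (simp add: of_nat_diff algebra_simps eval_nat_numeral)
  finally show ?thesis .
qed

lemma card_Sp_2: "card (Sp 2 :: 'a mat set) = q ^ 4 * (q ^ 2 - 1) * (q ^ 4 - 1)"
  using sum_Sp_2[of "\<lambda>_ :: 'a. 1::nat"] card_symplectic_bases by simp

end

section \<open>Trace distributions and moment recursions\<close>

lemma sum_lessThan_length:
  assumes "distinct xs"
  shows "(\<Sum>i<length xs. f (xs ! i)) = (\<Sum>x\<in>set xs. f x)"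
  by (rule sum.reindex_bij_betw[OF bij_betw_nth]) (use assms in auto)

lemma card_vimage_nth:
  assumes "distinct xs"
  shows "card {i \<in> {..<length xs}. P (xs ! i)} = card {x \<in> set xs. P x}"
proof (rule bij_betw_same_card)
  show "bij_betw ((!) xs) {i \<in> {..<length xs}. P (xs ! i)} {x \<in> set xs. P x}"
    using assms by (auto simp: bij_betw_def inj_on_def nth_eq_iff_index_eq in_set_conv_nth)
qed

section \<open>Squares, the general recursion and trace counts\<close>

context ternary_field
begin

lemma card_square_roots:
  "card {y. y ^ 2 = (D :: 'a)} = (if D = 0 then 1 else if is_square D then 2 else 0)"
proof (cases "is_square D")
  case True
  then obtain c where c: "D = c ^ 2" by (auto simp: is_nth_power_def)
  have "{y. y ^ 2 = D} = {c, - c}" by (auto simp: c power2_eq_iff)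
  moreover have "c = - c \<longleftrightarrow> c = 0"
  proof -
    have "c = - c \<longleftrightarrow> 2 * c = 0" by (simp only: eq_neg_iff_add_eq_0 mult_2)
    then show ?thesis by (simp add: two_eq)
  qed
  ultimately show ?thesis using True by (auto simp: c)
next
  case False
  then have "D \<noteq> 0" and "{y. y ^ 2 = D} = {}" by (auto simp: is_nth_power_def)
  then show ?thesis using False by simp
qed

text \<open>Squaring is two to one on the nonzero elements. The factor 2 cancels against that of
  \<open>dual_weight_moment\<close>.\<close>

lemma sum_squares:
  fixes F :: "'a \<Rightarrow> complex"
  shows "(\<Sum>a\<in>UNIV - {0}. F (a ^ 2)) = 2 * (\<Sum>b | b \<noteq> 0 \<and> is_square b. F b)"
proof -
  have "(\<Sum>a\<in>UNIV - {0}. F (a ^ 2)) =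
      (\<Sum>b\<in>{b. b \<noteq> 0 \<and> is_square b}. \<Sum>a\<in>{a \<in> UNIV - {0}. a ^ 2 = b}. F (a ^ 2))"
    by (rule sum.group[symmetric]) auto
  also have "\<dots> = (\<Sum>b | b \<noteq> 0 \<and> is_square b. 2 * F b)"
  proof (rule sum.cong[OF refl])
    fix b :: 'a assume b: "b \<in> {b. b \<noteq> 0 \<and> is_square b}"
    then have "{a \<in> UNIV - {0}. a ^ 2 = b} = {a. a ^ 2 = b}" by auto
    moreover have "card {a. a ^ 2 = b} = 2" using b by (simp add: card_square_roots)
    ultimately show "(\<Sum>a\<in>{a \<in> UNIV - {0}. a ^ 2 = b}. F (a ^ 2)) = 2 * F b" by simp
  qed
  finally show ?thesis by (simp add: sum_distrib_left)
qed

text \<open>Summing \<open>add_char_trace_indicator\<close> over the coordinates counts three times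
  those with trace 0.\<close>

lemma dual_weight_eq:
  "3 * of_nat (dual_weight N v a) =
    2 * of_nat N - (\<Sum>i<N. add_char r (a * v i)) - (\<Sum>i<N. add_char r (- a * v i))"
proof -
  have "(\<Sum>i<N. 1 + add_char r (a * v i) + add_char r (- a * v i)) =
      (\<Sum>i<N. 3 - 3 * (if field_trace r (a * v i) \<noteq> 0 then 1 else 0))"
    by (rule sum.cong[OF refl]) (simp add: add_char_trace_indicator)
  also have "\<dots> = 3 * of_nat N - 3 * of_nat (dual_weight N v a)"
    by (simp add: sum_subtractf sum_distrib_left[symmetric] dual_weight_def sum.inter_filter[symmetric])
  finally show ?thesis by (simp add: sum.distrib algebra_simps)
qed

text \<open>Equating the h-th power sum of the weights, expanded by the binomial theorem, with
  \<open>dual_weight_moment\<close> gives a linear relation between the moments \<open>P j\<close>,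
  which is solved for j = h. Keeping c, M and L abstract serves both groups.\<close>

lemma moment_recursion:
  fixes L :: "'a \<Rightarrow> complex"
  assumes gauss: "\<And>a. a \<noteq> 0 \<Longrightarrow> (\<Sum>i<N. add_char r (a * v i)) = of_nat N - c * (M - L (a ^ 2))"
    and c: "c \<noteq> 0" and h: "h \<ge> 1"
  defines "P \<equiv> \<lambda>j. \<Sum>b | b \<noteq> 0 \<and> is_square b. L b ^ j"
  shows "P h = (\<Sum>j=0..h-1. (-1) ^ (h + j + 1) * of_nat (h choose j) * M ^ (h - j) * P j) +
    of_nat q / c ^ h * moment_sum (num_codewords N v) N h"
proof -
  let ?m = "moment_sum (num_codewords N v) N h"
  have w: "of_nat (dual_weight N v a) = 2/3 * c * (M - L (a ^ 2))" if "a \<noteq> 0" for a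
  proof -
    \<comment> \<open>The hypothesis is used at a and at - a, which have the same square.\<close>
    have "3 * of_nat (dual_weight N v a) = 2 * of_nat N - (of_nat N - c * (M - L (a ^ 2))) - (of_nat N - c * (M - L (a ^ 2)))"
      using dual_weight_eq[of N v a] gauss[OF that] gauss[of "- a"] that by simp
    then show ?thesis by (simp add: field_simps)
  qed
  have bin: "(M - L b) ^ h = (\<Sum>j\<le>h. of_nat (h choose j) * (- L b) ^ j * M ^ (h - j))" for b
    using binomial_ring[of "- L b" M h] by simp
  \<comment> \<open>The index 0 gives the zero word; as h \<ge> 1, it drops out of the power
    sum.\<close>
  have w0: "dual_weight N v 0 = 0" by (simp add: dual_weight_def field_trace_0)
  have "of_nat q * (2 * (- 2/3) ^ h * ?m) = (\<Sum>a\<in>UNIV. of_nat (dual_weight N v a) ^ h)"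
    by (rule dual_weight_moment[symmetric])
  also have "\<dots> = (\<Sum>a\<in>UNIV - {0}. of_nat (dual_weight N v a) ^ h)"
    by (rule sum.mono_neutral_right) (use w0 h in auto)
  also have "\<dots> = (\<Sum>a\<in>UNIV - {0}. (2/3 * c) ^ h * (M - L (a ^ 2)) ^ h)"
    by (rule sum.cong[OF refl]) (simp add: w power_mult_distrib[symmetric])
  also have "\<dots> = 2 * (\<Sum>b | b \<noteq> 0 \<and> is_square b. (2/3 * c) ^ h * (M - L b) ^ h)"
    by (rule sum_squares)
  also have "\<dots> = 2 * (2/3 * c) ^ h * (\<Sum>b | b \<noteq> 0 \<and> is_square b. \<Sum>j\<le>h. of_nat (h choose j) * (- L b) ^ j * M ^ (h - j))"
    unfolding sum_distrib_left[symmetric] bin by (simp only: mult.assoc)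
  also have "(\<Sum>b | b \<noteq> 0 \<and> is_square b. \<Sum>j\<le>h. of_nat (h choose j) * (- L b) ^ j * M ^ (h - j)) =
      (\<Sum>j\<le>h. \<Sum>b | b \<noteq> 0 \<and> is_square b. of_nat (h choose j) * (- L b) ^ j * M ^ (h - j))"
    by (rule sum.swap)
  also have "\<dots> = (\<Sum>j\<le>h. (- 1) ^ j * of_nat (h choose j) * M ^ (h - j) * P j)"
    unfolding P_def sum_distrib_left
    by (intro sum.cong refl) (simp add: power_minus[of "L _"] mult_ac)
  finally have main: "of_nat q * (2 * (- 2/3) ^ h * ?m) =
      2 * (2/3 * c) ^ h * (\<Sum>j\<le>h. (- 1) ^ j * of_nat (h choose j) * M ^ (h - j) * P j)" .
  have "(- 2/3 :: complex) ^ h = (- 1) ^ h * (2/3) ^ h"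
    by (metis power_minus minus_divide_left)
  then have "of_nat q * ((- 1) ^ h * ?m) * (2 * (2/3) ^ h) =
      c ^ h * (\<Sum>j\<le>h. (- 1) ^ j * of_nat (h choose j) * M ^ (h - j) * P j) * (2 * (2/3) ^ h)"
    using main by (simp only: power_mult_distrib mult_ac)
  then have "of_nat q * ((- 1) ^ h * ?m) = c ^ h * (\<Sum>j\<le>h. (- 1) ^ j * of_nat (h choose j) * M ^ (h - j) * P j)"
    by (subst (asm) mult_cancel_right) simp
  then have "(\<Sum>j\<le>h. (- 1) ^ j * of_nat (h choose j) * M ^ (h - j) * P j) = (- 1) ^ h * (of_nat q / c ^ h * ?m)"
    using c by (simp add: field_simps)
  moreover have "(\<Sum>j\<le>h. (- 1) ^ j * of_nat (h choose j) * M ^ (h - j) * P j) =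
      (\<Sum>j=0..h-1. (- 1) ^ j * of_nat (h choose j) * M ^ (h - j) * P j) + (- 1) ^ h * P h"
    using h by (cases h) (simp_all add: atLeast0AtMost)
  ultimately have "(- 1) ^ h * ((\<Sum>j=0..h-1. (- 1) ^ j * of_nat (h choose j) * M ^ (h - j) * P j) + (- 1) ^ h * P h) =
      (- 1) ^ h * ((- 1) ^ h * (of_nat q / c ^ h * ?m))" by simp
  then have "(- 1) ^ h * (\<Sum>j=0..h-1. (- 1) ^ j * of_nat (h choose j) * M ^ (h - j) * P j) + P h =
      of_nat q / c ^ h * ?m"
    by (simp only: distrib_left mult.assoc[symmetric] power_mult_distrib[symmetric]) simp
  moreover have "(- 1) ^ h * (\<Sum>j=0..h-1. (- 1) ^ j * of_nat (h choose j) * M ^ (h - j) * P j) =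
      - (\<Sum>j=0..h-1. (-1) ^ (h + j + 1) * of_nat (h choose j) * M ^ (h - j) * P j)"
    unfolding sum_distrib_left sum_negf[symmetric] by (intro sum.cong refl) (simp add: power_add mult_ac)
  ultimately show ?thesis by (simp add: algebra_simps)
qed

text \<open>In characteristic 3 the linear coefficient - \<beta> of x^2 - \<beta> x + 1 equals 2
  \<beta>, so x + 1 / x = \<beta> becomes (x + \<beta>)^2 = \<beta>^2 - 1. Each of its 1, 2 or 0
  roots adds q to the uniform count q (q - 1).\<close>

lemma card_trace_Sp_1:
  "card {g \<in> Sp 1. mat_trace g = (\<beta> :: 'a)} =
    (if \<beta> ^ 2 - 1 = 0 then q ^ 2 else if is_square (\<beta> ^ 2 - 1) then q ^ 2 + q else q ^ 2 - q)"
proof -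
  let ?F = "\<lambda>t. if t = \<beta> then 1 else 0 :: complex"
  have fin: "finite (Sp 1 :: 'a mat set)" 
    using q_gt_1 one_less_power[OF q_gt_1, of 2] by (intro card_ge_0_finite, unfold card_Sp_1) simp
  have "x + inverse x = \<beta> \<longleftrightarrow> (x + \<beta>) ^ 2 = \<beta> ^ 2 - 1" if "x \<noteq> 0" for x
  proof -
    have "x + inverse x = \<beta> \<longleftrightarrow> x * (x + inverse x) = x * \<beta>" using that by simp
    also have "\<dots> \<longleftrightarrow> x ^ 2 + 1 - x * \<beta> = 0" using that by (simp add: distrib_left power2_eq_square)
    also have "x ^ 2 + 1 - x * \<beta> = (x + \<beta>) ^ 2 - (\<beta> ^ 2 - 1) - 3 * (x * \<beta>)"
      by (simp add: power2_eq_square algebra_simps)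
    finally show ?thesis by (simp add: three_eq_0)
  qed
  moreover have "x \<noteq> 0" if "(x + \<beta>) ^ 2 = \<beta> ^ 2 - 1" for x
    using that by (auto simp: algebra_simps)
  ultimately have "{x \<in> UNIV - {0}. x + inverse x = \<beta>} = {x. (x + \<beta>) ^ 2 = \<beta> ^ 2 - 1}" by auto
  moreover have "card {x. (x + \<beta>) ^ 2 = \<beta> ^ 2 - 1} = card {y. y ^ 2 = \<beta> ^ 2 - 1}"
    by (rule bij_betw_same_card[OF bij_betw_byWitness[where f = "\<lambda>x. x + \<beta>" and f' = "\<lambda>y. y - \<beta>"]]) auto
  ultimately have roots: "card {x \<in> UNIV - {0}. x + inverse x = \<beta>} =
      (if \<beta> ^ 2 - 1 = 0 then 1 else if is_square (\<beta> ^ 2 - 1) then 2 else 0)"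
    by (simp only: card_square_roots)
  have "of_nat (card {g \<in> Sp 1. mat_trace g = \<beta>}) = (\<Sum>g\<in>Sp 1. ?F (mat_trace g))"
    using fin by (simp add: sum.inter_filter[symmetric])
  also have "\<dots> = of_nat (q - 1) * (\<Sum>x\<in>UNIV. \<Sum>y\<in>UNIV. ?F (x + y)) +
      of_nat q * (\<Sum>x\<in>UNIV - {0}. ?F (x + inverse x))" by (rule sum_Sp_1_trace)
  also have "(\<Sum>x\<in>UNIV - {0}. ?F (x + inverse x)) = of_nat (card {x \<in> UNIV - {0}. x + inverse x = \<beta>})"
    by (simp add: sum.inter_filter[symmetric])
  also have "(\<Sum>x\<in>UNIV. \<Sum>y\<in>UNIV. ?F (x + y)) = of_nat q"
  proof -
    have "x + y = \<beta> \<longleftrightarrow> y = \<beta> - x" for x y by (auto simp: algebra_simps)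
    then show ?thesis by (simp add: card_field)
  qed
  finally have "card {g \<in> Sp 1. mat_trace g = \<beta>} = (q - 1) * q + q * card {x \<in> UNIV - {0}. x + inverse x = \<beta>}"
    unfolding of_nat_mult[symmetric] of_nat_add[symmetric] of_nat_eq_iff .
  then show ?thesis
    unfolding roots using q_gt_1 by (auto simp: power2_eq_square algebra_simps)
qed

text \<open>Orthogonality written as an indicator of f g = \<beta>. The index a = 0 is split off
  because the Gauss sum formulas are stated for nonzero a.\<close>

lemma fourier_count:
  fixes G :: "'g set" and f :: "'g \<Rightarrow> 'a"
  assumes "finite G"
  shows "of_nat q * of_nat (card {g \<in> G. f g = \<beta>}) =
    of_nat (card G) + (\<Sum>a\<in>UNIV - {0}. add_char r (- \<beta> * a) * (\<Sum>g\<in>G. add_char r (a * f g)))"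
proof -
  have "of_nat q * of_nat (card {g \<in> G. f g = \<beta>}) = (\<Sum>g\<in>G. if f g = \<beta> then of_nat q else 0 :: complex)"
    using assms by (simp add: sum.inter_filter[symmetric])
  also have "\<dots> = (\<Sum>g\<in>G. \<Sum>a\<in>UNIV. add_char r ((f g - \<beta>) * a))"
    by (simp add: sum_add_char)
  also have "\<dots> = (\<Sum>a\<in>UNIV. \<Sum>g\<in>G. add_char r ((f g - \<beta>) * a))" by (rule sum.swap)
  also have "\<dots> = (\<Sum>a\<in>UNIV. add_char r (- \<beta> * a) * (\<Sum>g\<in>G. add_char r (a * f g)))"
    unfolding sum_distrib_left add_char_add[symmetric] by (simp add: algebra_simps)
  finally show ?thesis
    by (simp add: sum.remove[of UNIV "0::'a"])
qed

text \<open>The squared Kloosterman sum is a sum over pairs, and orthogonality over all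
  \<open>a\<close> selects the pairs counted by \<open>delta2\<close>.\<close>

lemma sum_kloosterman_squared:
  "(\<Sum>a\<in>UNIV - {0}. add_char r (- \<beta> * a) * kloosterman r (a ^ 2) ^ 2) =
    of_nat q * of_nat (delta2 \<beta>) - of_nat (q - 1) ^ 2" for \<beta> :: 'a
proof -
  \<comment> \<open>At a = 0 this symmetric form is q - 1, as the full sum over pairs requires,
    whereas \<open>kloosterman r 0\<close> is - 1.\<close>
  let ?k = "\<lambda>a. \<Sum>x\<in>UNIV - {0}. add_char r (a * (x + inverse x))"
  let ?X = "(UNIV - {0 :: 'a}) \<times> (UNIV - {0 :: 'a})"
  let ?f = "\<lambda>(x, y). x + inverse x + y + inverse y"
  have "add_char r (- \<beta> * a) * ?k a ^ 2 = (\<Sum>p\<in>?X. add_char r ((?f p - \<beta>) * a))" for a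
  proof -
    have "add_char r (- \<beta> * a) * ?k a ^ 2 = (\<Sum>x\<in>UNIV - {0}. \<Sum>y\<in>UNIV - {0}. add_char r (- \<beta> * a) *
        (add_char r (a * (x + inverse x)) * add_char r (a * (y + inverse y))))"
      unfolding power2_eq_square sum_product unfolding sum_distrib_left ..
    also have "\<dots> = (\<Sum>x\<in>UNIV - {0}. \<Sum>y\<in>UNIV - {0}. add_char r ((?f (x, y) - \<beta>) * a))"
      unfolding add_char_add[symmetric] by (rule sum.cong[OF refl], rule sum.cong[OF refl]) (simp add: algebra_simps)
    finally show ?thesis by (simp add: sum.cartesian_product split_def)
  qed
  then have "(\<Sum>a\<in>UNIV. add_char r (- \<beta> * a) * ?k a ^ 2) = (\<Sum>p\<in>?X. \<Sum>a\<in>UNIV. add_char r ((?f p - \<beta>) * a))"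
    by (simp only: sum.swap[of _ ?X])
  also have "\<dots> = of_nat q * of_nat (card {p \<in> ?X. ?f p = \<beta>})"
    by (simp add: sum_add_char sum.inter_filter[symmetric] del: mult_eq_0_iff)
  also have "{p \<in> ?X. ?f p = \<beta>} = {(x, y). x \<noteq> 0 \<and> y \<noteq> 0 \<and> x + inverse x + y + inverse y = \<beta>}" by auto
  also have "card \<dots> = delta2 \<beta>" by (simp add: delta2_def)
  finally have "(\<Sum>a\<in>UNIV. add_char r (- \<beta> * a) * ?k a ^ 2) = of_nat q * of_nat (delta2 \<beta>)" .
  moreover have "(\<Sum>a\<in>UNIV. add_char r (- \<beta> * a) * ?k a ^ 2) =
      of_nat (q - 1) ^ 2 + (\<Sum>a\<in>UNIV - {0}. add_char r (- \<beta> * a) * ?k a ^ 2)"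
    by (subst sum.remove[of UNIV "0::'a"]) (simp_all add: card_Diff_subset card_field)
  moreover have "(\<Sum>a\<in>UNIV - {0}. add_char r (- \<beta> * a) * ?k a ^ 2) =
      (\<Sum>a\<in>UNIV - {0}. add_char r (- \<beta> * a) * kloosterman r (a ^ 2) ^ 2)"
    by (intro sum.cong refl) (simp add: kloosterman_square)
  ultimately show ?thesis by simp
qed

text \<open>Fourier inversion of \<open>gauss_sum_Sp_2\<close>. Its constant q^3 - q is multiplied
  by the plain sum of \<lambda>(- \<beta> a) over nonzero a, which is q - 1 for \<beta> = 0 and - 1
  otherwise; hence the separate term at \<beta> = 0.\<close>

lemma card_trace_Sp_2:
  "int (card {g \<in> Sp 2. mat_trace g = (\<beta> :: 'a)}) =
    int q ^ 4 * (int (delta2 \<beta>) + int q ^ 5 - int q ^ 3 - int q ^ 2 - 2 * int q + 3 +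
      (if \<beta> = 0 then int q ^ 3 - int q else 0))"
proof -
  let ?n = "card {g \<in> Sp 2. mat_trace g = \<beta>}"
  let ?Q = "of_nat q :: complex"
  have fin: "finite (Sp 2 :: 'a mat set)"
  proof (rule card_ge_0_finite)
    show "0 < card (Sp 2 :: 'a mat set)"
      using q_gt_1 one_less_power[OF q_gt_1, of 2] one_less_power[OF q_gt_1, of 4]
      unfolding card_Sp_2 by simp
  qed
  have N: "of_nat (card (Sp 2 :: 'a mat set)) = ?Q ^ 4 * (?Q ^ 2 - 1) * (?Q ^ 4 - 1)"
    using q_gt_1 by (simp add: card_Sp_2 of_nat_diff one_le_power)
  have lin: "(\<Sum>a\<in>UNIV - {0}. add_char r (- \<beta> * a)) = (if \<beta> = 0 then ?Q else 0) - 1"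
    using sum.remove[of UNIV "0::'a" "\<lambda>a. add_char r (- \<beta> * a)"] sum_add_char[of "- \<beta>"]
    by (simp add: card_field eq_diff_eq add.commute)
  have "?Q * of_nat ?n = of_nat (card (Sp 2 :: 'a mat set)) +
      (\<Sum>a\<in>UNIV - {0}. add_char r (- \<beta> * a) * (\<Sum>g\<in>Sp 2. add_char r (a * mat_trace g)))"
    by (rule fourier_count[OF fin])
  also have "(\<Sum>a\<in>UNIV - {0}. add_char r (- \<beta> * a) * (\<Sum>g\<in>Sp 2. add_char r (a * mat_trace g))) =
      (\<Sum>a\<in>UNIV - {0}. ?Q ^ 4 * (add_char r (- \<beta> * a) * kloosterman r (a ^ 2) ^ 2) +
        ?Q ^ 4 * (?Q ^ 3 - ?Q) * add_char r (- \<beta> * a))"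
    by (rule sum.cong[OF refl]) (simp add: gauss_sum_Sp_2, simp add: algebra_simps)
  also have "\<dots> = ?Q ^ 4 * (?Q * of_nat (delta2 \<beta>) - of_nat (q - 1) ^ 2) +
      ?Q ^ 4 * (?Q ^ 3 - ?Q) * ((if \<beta> = 0 then ?Q else 0) - 1)"
    unfolding sum.distrib sum_distrib_left[symmetric] sum_kloosterman_squared lin ..
  also have "of_nat (card (Sp 2 :: 'a mat set)) + \<dots> = ?Q * (?Q ^ 4 * (of_nat (delta2 \<beta>) + ?Q ^ 5 - ?Q ^ 3 - ?Q ^ 2 - 2 * ?Q + 3 +
      (if \<beta> = 0 then ?Q ^ 3 - ?Q else 0)))"
    using q_gt_1 unfolding N by (simp add: of_nat_diff algebra_simps eval_nat_numeral)
  finally have "of_nat ?n = ?Q ^ 4 * (of_nat (delta2 \<beta>) + ?Q ^ 5 - ?Q ^ 3 - ?Q ^ 2 - 2 * ?Q + 3 +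
      (if \<beta> = 0 then ?Q ^ 3 - ?Q else 0))"
    using q_gt_1 by (subst (asm) mult_left_cancel) auto
  then have "(of_int (int ?n) :: complex) = of_int (int q ^ 4 * (int (delta2 \<beta>) + int q ^ 5 - int q ^ 3 - int q ^ 2 - 2 * int q + 3 +
      (if \<beta> = 0 then int q ^ 3 - int q else 0)))"
    by simp
  then show ?thesis by (simp only: of_int_eq_iff)
qed

section \<open>Weight distributions and recursions for the two groups\<close>

lemma num_codewords_trace_code:
  fixes gs :: "'a mat list"
  assumes "distinct gs"
  shows "weight_distribution (trace_code gs) j = (\<Sum>(\<nu>, \<mu>)\<in>weight_families j.
    \<Prod>\<beta>\<in>UNIV. trinomial (card {g \<in> set gs. mat_trace g = \<beta>}) (\<nu> \<beta>) (\<mu> \<beta>))"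
  unfolding weight_distribution_trace_code num_codewords_eq card_vimage_nth[OF assms, of "\<lambda>g. mat_trace g = _"] ..

lemma prod_by_discriminant:
  fixes t :: "nat \<Rightarrow> 'a \<Rightarrow> nat"
  shows "(\<Prod>\<beta>\<in>UNIV. t (if \<beta> ^ 2 - 1 = 0 then x else if is_square (\<beta> ^ 2 - 1) then y else z) \<beta>) =
    t x 1 * t x (- 1) * (\<Prod>\<beta> | \<beta> ^ 2 - 1 \<noteq> 0 \<and> is_square (\<beta> ^ 2 - 1). t y \<beta>) *
    (\<Prod>\<beta> | \<not> is_square (\<beta> ^ 2 - 1). t z \<beta>)"
proof -
  let ?f = "\<lambda>\<beta>. t (if \<beta> ^ 2 - 1 = 0 then x else if is_square (\<beta> ^ 2 - 1) then y else z) \<beta>"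
  let ?Z = "{1, - 1 :: 'a}" and ?S = "{\<beta> :: 'a. \<beta> ^ 2 - 1 \<noteq> 0 \<and> is_square (\<beta> ^ 2 - 1)}"
    and ?N = "{\<beta> :: 'a. \<not> is_square (\<beta> ^ 2 - 1)}"
  have Z: "\<beta> ^ 2 - 1 = 0 \<longleftrightarrow> \<beta> \<in> ?Z" for \<beta> :: 'a by (simp add: power2_eq_1_iff)
  \<comment> \<open>0 counts as a square, so it must be taken out of the squares explicitly, while
    nonsquares are nonzero anyway.\<close>
  have sq0: "is_square (0 :: 'a)" by (auto simp: is_nth_power_def intro: exI[of _ 0])
  have U: "UNIV = ?Z \<union> (?S \<union> ?N)" using Z by blast
  have d: "?Z \<inter> (?S \<union> ?N) = {}" "?S \<inter> ?N = {}" using Z sq0 by auto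
  have "prod ?f UNIV = prod ?f ?Z * (prod ?f ?S * prod ?f ?N)"
    using d by (subst U) (simp only: prod.union_disjoint finite)
  also have "prod ?f ?Z = t x 1 * t x (- 1)" using signs_distinct by simp
  also have "prod ?f ?S = (\<Prod>\<beta>\<in>?S. t y \<beta>)" by (rule prod.cong) auto
  also have "prod ?f ?N = (\<Prod>\<beta>\<in>?N. t z \<beta>)" by (rule prod.cong) (use sq0 in auto)
  finally show ?thesis by (simp only: mult.assoc)
qed

text \<open>The case L = K, c = q of \<open>moment_recursion\<close>, where M is N / q = q^2 -
  1.\<close>

lemma moment_recursion_Sp_1:
  fixes gs :: "'a mat list"
  assumes "distinct gs" "set gs = Sp 1" "h \<ge> 1"
  shows "SK TYPE('a) r h =
    (\<Sum>j=0..h-1. (-1) ^ (h + j + 1) * of_nat (h choose j) * (of_nat q ^ 2 - 1) ^ (h - j) * SK TYPE('a) r j) +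
    of_nat q powi (1 - int h) * moment_sum (weight_distribution (trace_code gs)) (card (Sp 1 :: 'a mat set)) h"
proof -
  have len: "length gs = card (Sp 1 :: 'a mat set)" using assms distinct_card by metis
  have Q: "(of_nat q :: complex) \<noteq> 0" using q_gt_1 by simp
  have N: "of_nat (length gs) = of_nat q * (of_nat q ^ 2 - 1 :: complex)"
    using one_less_power[OF q_gt_1, of 2] by (simp add: len card_Sp_1[unfolded One_nat_def] of_nat_diff)
  have "(\<Sum>i<length gs. add_char r (a * mat_trace (gs ! i))) =
      of_nat (length gs) - of_nat q * ((of_nat q ^ 2 - 1) - kloosterman r (a ^ 2))" if "a \<noteq> 0" for a
    unfolding sum_lessThan_length[OF assms(1), of "\<lambda>g. add_char r (a * mat_trace g)"] assms(2)
      gauss_sum_Sp_1[OF that] N by (simp add: algebra_simps)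
  from moment_recursion[OF this Q assms(3)]
  have "SK TYPE('a) r h =
    (\<Sum>j=0..h-1. (-1) ^ (h + j + 1) * of_nat (h choose j) * (of_nat q ^ 2 - 1) ^ (h - j) * SK TYPE('a) r j) +
    of_nat q / of_nat q ^ h * moment_sum (num_codewords (length gs) (\<lambda>i. mat_trace (gs ! i))) (length gs) h"
    unfolding SK_def .
  also have "of_nat q / of_nat q ^ h = (of_nat q powi (1 - int h) :: complex)"
    using Q by (simp add: power_int_diff)
  also have "num_codewords (length gs) (\<lambda>i. mat_trace (gs ! i)) = weight_distribution (trace_code gs)"
    by (rule ext) (rule weight_distribution_trace_code[symmetric])
  finally show ?thesis unfolding len .
qed

text \<open>The case L = K^2, c = q^4 of \<open>moment_recursion\<close>. The constant q^3 - q in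
  the Gauss sum makes M equal to (q^2 - 1) (q^4 - 1) - (q^3 - q).\<close>

lemma moment_recursion_Sp_2:
  fixes gs :: "'a mat list"
  assumes "distinct gs" "set gs = Sp 2" "h \<ge> 1"
  shows "SK TYPE('a) r (2 * h) =
    (\<Sum>j=0..h-1. (-1) ^ (h + j + 1) * of_nat (h choose j) *
      (of_nat q ^ 6 - of_nat q ^ 4 - of_nat q ^ 3 - of_nat q ^ 2 + of_nat q + 1) ^ (h - j) * SK TYPE('a) r (2 * j)) +
    of_nat q powi (1 - 4 * int h) * moment_sum (weight_distribution (trace_code gs)) (card (Sp 2 :: 'a mat set)) h"
proof -
  let ?M = "of_nat q ^ 6 - of_nat q ^ 4 - of_nat q ^ 3 - of_nat q ^ 2 + of_nat q + 1 :: complex"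
  have len: "length gs = card (Sp 2 :: 'a mat set)" using assms distinct_card by metis
  have Q: "(of_nat q ^ 4 :: complex) \<noteq> 0" using q_gt_1 by simp
  have N: "of_nat (length gs) = of_nat q ^ 4 * (of_nat q ^ 2 - 1) * (of_nat q ^ 4 - 1 :: complex)"
    using one_less_power[OF q_gt_1, of 2] one_less_power[OF q_gt_1, of 4] by (simp add: len card_Sp_2 of_nat_diff)
  have "(\<Sum>i<length gs. add_char r (a * mat_trace (gs ! i))) =
      of_nat (length gs) - of_nat q ^ 4 * (?M - kloosterman r (a ^ 2) ^ 2)" if "a \<noteq> 0" for a
    unfolding sum_lessThan_length[OF assms(1), of "\<lambda>g. add_char r (a * mat_trace g)"] assms(2)
      gauss_sum_Sp_2[OF that] N by (simp add: algebra_simps eval_nat_numeral)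
  from moment_recursion[of _ _ _ _ "\<lambda>b. kloosterman r b ^ 2", OF this Q assms(3)]
  have "SK TYPE('a) r (2 * h) =
    (\<Sum>j=0..h-1. (-1) ^ (h + j + 1) * of_nat (h choose j) * ?M ^ (h - j) * SK TYPE('a) r (2 * j)) +
    of_nat q / (of_nat q ^ 4) ^ h * moment_sum (num_codewords (length gs) (\<lambda>i. mat_trace (gs ! i))) (length gs) h"
    unfolding SK_def power_mult .
  also have "of_nat q / (of_nat q ^ 4) ^ h = (of_nat q powi (1 - 4 * int h) :: complex)"
  proof -
    have "of_nat q powi (1 - int (4 * h)) = (of_nat q / of_nat q ^ (4 * h) :: complex)"
      using q_gt_1 by (subst power_int_diff) (simp_all only: power_int_of_nat power_int_1_right, simp)
    then show ?thesis by (simp add: power_mult)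
  qed
  also have "num_codewords (length gs) (\<lambda>i. mat_trace (gs ! i)) = weight_distribution (trace_code gs)"
    by (rule ext) (rule weight_distribution_trace_code[symmetric])
  finally show ?thesis unfolding len .
qed

lemma weight_distribution_Sp_1:
  fixes gs :: "'a mat list"
  assumes "distinct gs" "set gs = Sp 1"
  shows "weight_distribution (trace_code gs) j =
    (\<Sum>(\<nu>, \<mu>) \<in> (weight_families j :: (('a \<Rightarrow> nat) \<times> ('a \<Rightarrow> nat)) set).
       trinomial (q ^ 2) (\<nu> 1) (\<mu> 1) *
       trinomial (q ^ 2) (\<nu> (-1)) (\<mu> (-1)) *
       (\<Prod>\<beta> | \<beta> ^ 2 - 1 \<noteq> 0 \<and> is_square (\<beta> ^ 2 - 1). trinomial (q ^ 2 + q) (\<nu> \<beta>) (\<mu> \<beta>)) *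
       (\<Prod>\<beta> | \<not> is_square (\<beta> ^ 2 - 1). trinomial (q ^ 2 - q) (\<nu> \<beta>) (\<mu> \<beta>)))"
  unfolding num_codewords_trace_code[OF assms(1)] assms(2) card_trace_Sp_1
  by (intro sum.cong refl, clarify) (rule prod_by_discriminant[of "\<lambda>n \<beta>. trinomial n (_ \<beta>) (_ \<beta>)"])

lemma weight_distribution_Sp_2:
  fixes gs :: "'a mat list"
  assumes "distinct gs" "set gs = Sp 2"
  shows "weight_distribution (trace_code gs) j =
    (\<Sum>(\<nu>, \<mu>) \<in> (weight_families j :: (('a \<Rightarrow> nat) \<times> ('a \<Rightarrow> nat)) set).
       trinomial
         (nat (int q ^ 4 * (int (delta2 (0 :: 'a)) + int q ^ 5 - int q ^ 2 - 3 * int q + 3)))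
         (\<nu> 0) (\<mu> 0) *
       (\<Prod>\<beta>\<in>UNIV - {0}. trinomial
         (nat (int q ^ 4 * (int (delta2 \<beta>) + int q ^ 5 - int q ^ 3 - int q ^ 2 - 2 * int q + 3)))
         (\<nu> \<beta>) (\<mu> \<beta>)))"
proof -
  \<comment> \<open>As a cardinality is unchanged by \<open>nat (int _)\<close>, the integer formula
    transfers without a separate check that it is nonnegative.\<close>
  have "card {g \<in> Sp 2. mat_trace g = (0 :: 'a)} =
      nat (int (card {g \<in> Sp 2. mat_trace g = (0 :: 'a)}))" by (simp only: nat_int)
  also have "\<dots> = nat (int q ^ 4 * (int (delta2 (0 :: 'a)) + int q ^ 5 - int q ^ 2 - 3 * int q + 3))"
    unfolding card_trace_Sp_2 by (rule arg_cong[of _ _ nat]) (simp add: algebra_simps)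
  finally have z: "card {g \<in> Sp 2. mat_trace g = (0 :: 'a)} =
    nat (int q ^ 4 * (int (delta2 (0 :: 'a)) + int q ^ 5 - int q ^ 2 - 3 * int q + 3))" .
  have n: "card {g \<in> Sp 2. mat_trace g = \<beta>} =
      nat (int q ^ 4 * (int (delta2 \<beta>) + int q ^ 5 - int q ^ 3 - int q ^ 2 - 2 * int q + 3))"
    if "\<beta> \<noteq> 0" for \<beta> :: 'a
  proof -
    have "card {g \<in> Sp 2. mat_trace g = \<beta>} = nat (int (card {g \<in> Sp 2. mat_trace g = \<beta>}))"
      by (simp only: nat_int)
    then show ?thesis unfolding card_trace_Sp_2 using that by simp
  qed
  show ?thesis
    unfolding num_codewords_trace_code[OF assms(1)] assms(2)
  proof (rule sum.cong[OF refl], clarify)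
    fix \<nu> \<mu> :: "'a \<Rightarrow> nat"
    let ?t = "\<lambda>\<beta>. trinomial (card {g \<in> Sp 2. mat_trace g = \<beta>}) (\<nu> \<beta>) (\<mu> \<beta>)"
    have "prod ?t UNIV = ?t 0 * prod ?t (UNIV - {0})" by (rule prod.remove) auto
    also have "prod ?t (UNIV - {0}) = (\<Prod>\<beta>\<in>UNIV - {0}. trinomial
         (nat (int q ^ 4 * (int (delta2 \<beta>) + int q ^ 5 - int q ^ 3 - int q ^ 2 - 2 * int q + 3)))
         (\<nu> \<beta>) (\<mu> \<beta>))" by (intro prod.cong refl) (simp only: n DiffE singletonI Diff_iff insert_iff empty_iff simp_thms)
    finally show "prod ?t UNIV = trinomial
         (nat (int q ^ 4 * (int (delta2 (0 :: 'a)) + int q ^ 5 - int q ^ 2 - 3 * int q + 3)))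
         (\<nu> 0) (\<mu> 0) *
       (\<Prod>\<beta>\<in>UNIV - {0}. trinomial
         (nat (int q ^ 4 * (int (delta2 \<beta>) + int q ^ 5 - int q ^ 3 - int q ^ 2 - 2 * int q + 3)))
         (\<nu> \<beta>) (\<mu> \<beta>))" unfolding z .
  qed
qed

end

theorem theorem1:
  fixes q r N1 N2 :: nat
    and gs1 gs2 :: "'a::{field,finite} mat list"
    and C1 C2 :: "nat \<Rightarrow> nat"
  assumes "r \<ge> 1" and "q = 3 ^ r" and "CARD('a) = q"
    and "distinct gs1" and "set gs1 = Sp 1"
    and "distinct gs2" and "set gs2 = Sp 2"
    and "N1 = card (Sp 1 :: 'a mat set)" and "N2 = card (Sp 2 :: 'a mat set)"
    and "C1 = weight_distribution (trace_code gs1)"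
    and "C2 = weight_distribution (trace_code gs2)"
  shows
   "(N1 = q * (q ^ 2 - 1) \<and>
     (\<forall>j\<le>N1. C1 j =
        (\<Sum>(\<nu>, \<mu>) \<in> (weight_families j :: (('a \<Rightarrow> nat) \<times> ('a \<Rightarrow> nat)) set).
           trinomial (q ^ 2) (\<nu> 1) (\<mu> 1) *
           trinomial (q ^ 2) (\<nu> (-1)) (\<mu> (-1)) *
           (\<Prod>\<beta> | \<beta> ^ 2 - 1 \<noteq> 0 \<and> is_square (\<beta> ^ 2 - 1). trinomial (q ^ 2 + q) (\<nu> \<beta>) (\<mu> \<beta>)) *
           (\<Prod>\<beta> | \<not> is_square (\<beta> ^ 2 - 1). trinomial (q ^ 2 - q) (\<nu> \<beta>) (\<mu> \<beta>)))) \<and>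
     (\<forall>h\<ge>1. SK TYPE('a) r h =
        (\<Sum>j=0..h-1. (-1) ^ (h + j + 1) * of_nat (h choose j) *
           (of_nat q ^ 2 - 1) ^ (h - j) * SK TYPE('a) r j) +
        of_nat q powi (1 - int h) *
        (\<Sum>j=0..min N1 h. (-1) ^ (h + j) * of_nat (C1 j) *
           (\<Sum>t=j..h. fact t * of_nat (Stirling h t) * 3 ^ (h - t) *
              2 powi (int t - int h - int j - 1) *
              of_nat (if t \<le> N1 then (N1 - j) choose (N1 - t) else 0))))) \<and>
    (N2 = q ^ 4 * (q ^ 2 - 1) * (q ^ 4 - 1) \<and>
     (\<forall>j\<le>N2. C2 j =
        (\<Sum>(\<nu>, \<mu>) \<in> (weight_families j :: (('a \<Rightarrow> nat) \<times> ('a \<Rightarrow> nat)) set).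
           trinomial
             (nat (int q ^ 4 * (int (delta2 (0 :: 'a)) + int q ^ 5 - int q ^ 2 - 3 * int q + 3)))
             (\<nu> 0) (\<mu> 0) *
           (\<Prod>\<beta>\<in>UNIV - {0}. trinomial
             (nat (int q ^ 4 * (int (delta2 \<beta>) + int q ^ 5 - int q ^ 3 - int q ^ 2 - 2 * int q + 3)))
             (\<nu> \<beta>) (\<mu> \<beta>)))) \<and>
     (\<forall>h\<ge>1. SK TYPE('a) r (2 * h) =
        (\<Sum>j=0..h-1. (-1) ^ (h + j + 1) * of_nat (h choose j) *
           (of_nat q ^ 6 - of_nat q ^ 4 - of_nat q ^ 3 - of_nat q ^ 2 + of_nat q + 1) ^ (h - j) *
           SK TYPE('a) r (2 * j)) +
        of_nat q powi (1 - 4 * int h) *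
        (\<Sum>j=0..min N2 h. (-1) ^ (h + j) * of_nat (C2 j) *
           (\<Sum>t=j..h. fact t * of_nat (Stirling h t) * 3 ^ (h - t) *
              2 powi (int t - int h - int j - 1) *
              of_nat (if t \<le> N2 then (N2 - j) choose (N2 - t) else 0)))))"
proof -
  interpret ternary_field r q "TYPE('a)"
    by unfold_locales (use assms in auto)
  show ?thesis
    unfolding \<open>N1 = _\<close> \<open>N2 = _\<close> \<open>C1 = _\<close> \<open>C2 = _\<close>
    using card_Sp_1 card_Sp_2 weight_distribution_Sp_1[OF assms(4,5)] weight_distribution_Sp_2[OF assms(6,7)]
      moment_recursion_Sp_1[OF assms(4,5), unfolded moment_sum_def]
      moment_recursion_Sp_2[OF assms(6,7), unfolded moment_sum_def]
    by (intro conjI allI impI)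
qed

end
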